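(* Let $\beta\in[1,2)$ be fixed. Let $\mathbf{X}=(X_t)_{t\ge0}$ be a symmetric Lévy process in $\mathbb{R}^d$ with $X_0=0$ and Lévy–Khintchine exponent $\psi$, and let $\psi^*(u)=\sup_{\|x\|\le u}\psi(x)$. Assume that there are constants $c,C>0$ such that $$c\,\psi^*(\|x\|)\le\psi(x)\le C\,\psi^*(\|x\|)\quad\text{for }\|x\|\ge1 .$$ Suppose that there are a function $V$ regularly varying at infinity of index $\alpha\in(\beta,2]$ and a continuous function $\Lambda:\mathbb{S}^{d-1}\to(0,\infty)$ such that $$\lim_{s\to\infty}\frac{\psi(s\theta)}{V(s)}=\Lambda(\theta),\qquad\theta\in\mathbb{S}^{d-1}.$$ Let $g:\mathbb{R}^d\to\mathbb{R}$ be a bounded Borel function and $\mu$ a finite Borel measure on $\mathbb{R}^d$. Set $r(x)=\int_{\mathbb{R}^d}g(x+y)\,\mu(dy)$ and assume that the limit $$R_\beta(\theta)=\lim_{t\to0^+}t^{-\beta}\left(r(t\theta)+r(-t\theta)-2r(0)\right)$$ exists for all $\theta\in\mathbb{S}^{d-1}$. Suppose moreover that for some $L>0$ $$|r(x)+r(-x)-2r(0)|\le L\|x\|^\beta\quad\text{for all }x\in\mathbb{R}^d.$$ Let $H_g^\mu(t)=\int_{\mathbb{R}^d}\mathbb{E}^xg(X_t)\,\mu(dx)$, $t\ge0$. Then $$\lim_{t\to0^+}[V^-(1/t)]^\beta\left(H_g^\mu(t)-H_g^\mu(0)\right)=\frac12\int_{\mathbb{R}^d}R_\beta\left(\frac{x}{\|x\|}\right)\|x\|^\beta\,p_\Lambda(x)\,dx,$$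 where the density function $p_\Lambda$ is uniquely determined by $$e^{-\Lambda\left(\frac{x}{\|x\|}\right)\|x\|^\alpha}=\int_{\mathbb{R}^d}e^{i\langle x,y\rangle}p_\Lambda(y)\,dy .$$
   Context: $\|\cdot\|$ and $\langle\cdot,\cdot\rangle$ are the Euclidean norm and scalar product; $\mathbb{S}^{d-1}$ is the unit sphere in $\mathbb{R}^d$. The Lévy–Khintchine exponent $\psi$ of a Lévy process $\mathbf{X}$ (with $X_0=0$) is given by $\mathbb{E}\,e^{i\langle x,X_t\rangle}=e^{-t\psi(x)}$, $$\psi(x)=\langle x,Ax\rangle-i\langle x,\gamma\rangle-\int_{\mathbb{R}^d}\left(e^{i\langle x,y\rangle}-1-i\langle x,y\rangle\mathbf{1}_{\{\|y\|\le1\}}\right)\nu(dy),$$ where $A$ is symmetric non-negative definite, $\gamma\in\mathbb{R}^d$, $\nu$ is a Lévy measure. $\mathbf{X}$ is symmetric if $\gamma=0$ and $\nu$ is symmetric (equivalently $X_t$ and $-X_t$ have the same law); then $\psi$ is real and non-negative. $\mathbb{E}^x$ denotes expectation for the process started at $x$, i.e. $\mathbb{E}^xg(X_t)=\mathbb{E}\,g(x+X_t)$ with $X_0=0$. A positive measurable function $V$ on $[0,\infty)$ is regularly varying at infinity of index $\alpha$ if $\lim_{s\to\infty}V(\lambda s)/V(s)=\lambda^\alpha$ for every $\lambda>0$; $V$ is taken to be locally bounded on $[0,\infty)$. Its generalized inverse is $V^-(u)=\inf\{x\ge0: V(x)\ge u\}$. The expression $\Lambda(x/\|x\|)\|x\|^\alpha$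 is read as $0$ at $x=0$. *)

theory Defs
  imports "HOL-Probability.Probability"
begin

text \<open>
  A Levy process is taken in the usual sense: it starts at 0, has independent and stationary
  increments, and is stochastically continuous. Cadlag paths are not required; every Levy process
  in this sense has a cadlag modification. Times are the non-negative reals; the values of
  \<open>X\<close> at negative times are irrelevant.
\<close>

locale levy_process = prob_space P for P :: "'w measure" +
  fixes X :: "real \<Rightarrow> 'w \<Rightarrow> real ^ 'd"
  assumes random_variable_X: "\<And>t. 0 \<le> t \<Longrightarrow> random_variable borel (X t)"
    and X_start: "AE \<omega> in P. X 0 \<omega> = 0"
    and independent_increments:
      "\<And>(n::nat) (\<tau>::nat \<Rightarrow> real). 0 \<le> \<tau> 0 \<Longrightarrow> mono_on {..n} \<tau> \<Longrightarrow>
         indep_vars (\<lambda>_. borel) (\<lambda>i \<omega>. X (\<tau> (Suc i)) \<omega> - X (\<tau> i) \<omega>) {..<n}"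
    and stationary_increments:
      "\<And>s t. 0 \<le> s \<Longrightarrow> s \<le> t \<Longrightarrow>
         distr P borel (\<lambda>\<omega>. X t \<omega> - X s \<omega>) = distr P borel (X (t - s))"
    and stochastically_continuous:
      "\<And>t \<epsilon>. 0 \<le> t \<Longrightarrow> 0 < \<epsilon> \<Longrightarrow>
         ((\<lambda>s. prob {\<omega> \<in> space P. dist (X s \<omega>) (X t \<omega>) > \<epsilon>}) \<longlongrightarrow> 0) (at t within {0..})"

definition levy_measure :: "(real ^ 'd) measure \<Rightarrow> bool" where
  "levy_measure \<nu> \<longleftrightarrow> sets \<nu> = sets borel \<and> emeasure \<nu> {0} = 0 \<and>
     (\<integral>\<^sup>+ y. ennreal (min 1 ((norm y)\<^sup>2)) \<partial>\<nu>) < \<infinity>"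

definition levy_triplet :: "real ^ 'd ^ 'd \<Rightarrow> real ^ 'd \<Rightarrow> (real ^ 'd) measure \<Rightarrow> bool" where
  "levy_triplet A \<gamma> \<nu> \<longleftrightarrow> transpose A = A \<and> (\<forall>x. 0 \<le> x \<bullet> (A *v x)) \<and> levy_measure \<nu>"

definition levy_khintchine ::
    "real ^ 'd ^ 'd \<Rightarrow> real ^ 'd \<Rightarrow> (real ^ 'd) measure \<Rightarrow> real ^ 'd \<Rightarrow> complex" where
  "levy_khintchine A \<gamma> \<nu> x =
     complex_of_real (x \<bullet> (A *v x)) - \<i> * complex_of_real (x \<bullet> \<gamma>)
     - (CLINT y|\<nu>. iexp (x \<bullet> y) - 1 - \<i> * complex_of_real (x \<bullet> y) * indicator (cball 0 1) y)"

definition levy_exponent ::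
    "'w measure \<Rightarrow> (real \<Rightarrow> 'w \<Rightarrow> real ^ 'd) \<Rightarrow> real ^ 'd ^ 'd \<Rightarrow> real ^ 'd \<Rightarrow>
     (real ^ 'd) measure \<Rightarrow> (real ^ 'd \<Rightarrow> complex) \<Rightarrow> bool" where
  "levy_exponent P X A \<gamma> \<nu> \<psi> \<longleftrightarrow>
     levy_triplet A \<gamma> \<nu> \<and> (\<forall>x. \<psi> x = levy_khintchine A \<gamma> \<nu> x) \<and>
     (\<forall>t\<ge>0. \<forall>x. (CLINT \<omega>|P. iexp (x \<bullet> X t \<omega>)) = exp (- complex_of_real t * \<psi> x))"

definition symmetric_triplet :: "real ^ 'd \<Rightarrow> (real ^ 'd) measure \<Rightarrow> bool" where
  "symmetric_triplet \<gamma> \<nu> \<longleftrightarrow> \<gamma> = 0 \<and> distr \<nu> borel uminus = \<nu>"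

text \<open>Exponents are complex-valued in general; the exponent of a symmetric process is real, so
  taking real parts below loses nothing.\<close>

definition sup_exponent :: "(real ^ 'd \<Rightarrow> complex) \<Rightarrow> real \<Rightarrow> real" where
  "sup_exponent \<psi> u = (SUP x\<in>{x. norm x \<le> u}. Re (\<psi> x))"

definition regularly_varying :: "real \<Rightarrow> (real \<Rightarrow> real) \<Rightarrow> bool" where
  "regularly_varying \<alpha> V \<longleftrightarrow>
     (\<forall>s\<ge>0. 0 < V s) \<and> V \<in> borel_measurable (restrict_space borel {0..}) \<and>
     (\<forall>K. compact K \<and> K \<subseteq> {0..} \<longrightarrow> bounded (V ` K)) \<and>
     (\<forall>l>0. ((\<lambda>s. V (l * s) / V s) \<longlongrightarrow> l powr \<alpha>) at_top)"

definition generalized_inverse :: "(real \<Rightarrow> real) \<Rightarrow> real \<Rightarrow> real" where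
  "generalized_inverse V u = Inf {x. 0 \<le> x \<and> u \<le> V x}"

definition translate_integral ::
    "(real ^ 'd \<Rightarrow> real) \<Rightarrow> (real ^ 'd) measure \<Rightarrow> real ^ 'd \<Rightarrow> real" where
  "translate_integral g \<mu> x = (LINT y|\<mu>. g (x + y))"

definition expectation_from ::
    "'w measure \<Rightarrow> (real \<Rightarrow> 'w \<Rightarrow> real ^ 'd) \<Rightarrow> (real ^ 'd \<Rightarrow> real) \<Rightarrow> real \<Rightarrow> real ^ 'd \<Rightarrow> real" where
  "expectation_from P X g t x = (LINT \<omega>|P. g (x + X t \<omega>))"

definition heat_content ::
    "'w measure \<Rightarrow> (real \<Rightarrow> 'w \<Rightarrow> real ^ 'd) \<Rightarrow> (real ^ 'd \<Rightarrow> real) \<Rightarrow> (real ^ 'd) measure \<Rightarrow> real \<Rightarrow> real" where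
  "heat_content P X g \<mu> t = (LINT x|\<mu>. expectation_from P X g t x)"

text \<open>Since \<open>0 /\<^sub>R 0 = 0\<close> and \<open>0 powr \<alpha> = 0\<close>, the exponent below vanishes at \<open>x = 0\<close>, whatever the
  value of \<open>\<Lambda>\<close> outside the unit sphere. At \<open>x = 0\<close> the equation says that \<open>p\<close> has total mass 1.\<close>

definition stable_density :: "real \<Rightarrow> (real ^ 'd \<Rightarrow> real) \<Rightarrow> (real ^ 'd \<Rightarrow> real) \<Rightarrow> bool" where
  "stable_density \<alpha> \<Lambda> p \<longleftrightarrow>
     p \<in> borel_measurable borel \<and> (\<forall>y. 0 \<le> p y) \<and> integrable lborel p \<and>
     (\<forall>x. complex_of_real (exp (- (\<Lambda> (x /\<^sub>R norm x) * norm x powr \<alpha>)))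
        = (CLINT y|lborel. iexp (x \<bullet> y) * complex_of_real (p y)))"

end

theory Submission
  imports Defs
begin

text \<open>
  Write \<open>f\<close> for the real exponent, \<open>f\<^sup>*\<close> for its supremum over balls, \<open>r\<close> for the translate integral of
  \<open>g\<close> against \<open>\<mu>\<close>, \<open>D(x) = r(x) + r(-x) - 2 r(0)\<close> and \<open>s(t) = V\<^sup>-(1/t)\<close>. By Fubini's theorem and the
  symmetry of the law of \<open>X\<^sub>t\<close>,
  \<open>H(t) - H(0) = E (r(X\<^sub>t) - r(0)) = 1/2 E D(X\<^sub>t)\<close>.
  With the rescaled variable \<open>Y\<^sub>t = s(t) X\<^sub>t\<close>, the quantity of interest becomes \<open>1/2 E F\<^sub>t(Y\<^sub>t)\<close> with
  \<open>F\<^sub>t(y) = s(t)\<^sup>\<beta> D(y / s(t))\<close>, and the hypothesis on \<open>R\<close> says that \<open>F\<^sub>t(y)\<close> tends to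
  \<open>R(y/|y|) |y|\<^sup>\<beta>\<close> for every \<open>y\<close>. So everything rests on a limit theorem for \<open>Y\<^sub>t\<close>
  (\<open>scaled_expectation_tendsto\<close>).

  Weak convergence of \<open>Y\<^sub>t\<close> would not be enough: the convergence of \<open>F\<^sub>t\<close> is only pointwise and its limit
  is only measurable. Densities are therefore needed. Since \<open>t V(s(t)) \<rightarrow> 1\<close>, the characteristic function
  \<open>exp (- t f(s(t) \<xi>))\<close> of \<open>Y\<^sub>t\<close> converges to \<open>exp (- \<Lambda>(\<xi>/|\<xi>|) |\<xi>|\<^sup>\<alpha>)\<close>, and it is dominated by a multiple
  of \<open>exp (- k |\<xi>|)\<close> because \<open>f\<close> is comparable to \<open>f\<^sup>*\<close> and \<open>f\<^sup>*\<close> grows faster than linearly. Fourier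
  inversion on the whole space, proved here by Gaussian smoothing, then gives densities of \<open>Y\<^sub>t\<close> that are
  uniformly bounded and converge pointwise.

  It remains to prevent loss of mass at infinity. The law of \<open>Y\<^sub>t\<close> need not have a moment of order \<open>\<beta>\<close>, since
  the large jumps of the process are arbitrary. But \<open>D\<close> is bounded, so \<open>|F\<^sub>t(y)|\<close> is at most a
  multiple of \<open>min(|y|, s(t))\<^sup>\<beta>\<close>, and for \<open>r \<le> s(t)\<close> the probability of \<open>|Y\<^sub>t| \<ge> r\<close> is \<open>O(r\<^sup>-\<^sup>a)\<close> for each
  \<open>a < \<alpha>\<close>, uniformly in small \<open>t\<close>. Summing over dyadic shells with \<open>\<beta> < a < \<alpha>\<close> makes the truncated moments
  uniformly small (\<open>tail_moment\<close>).

  All facts on regular variation reduce to two properties of \<open>f\<close>. Monotonicity of \<open>f\<^sup>*\<close> turns the doubling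
  relation \<open>f(2s\<theta>) / f(s\<theta>) \<rightarrow> 2\<^sup>\<alpha>\<close> into a Potter-type growth bound. The inequality
  \<open>f(x + y) \<le> (1 + \<kappa>) f(x) + (1 + 1/\<kappa>) f(y)\<close>, inherited from \<open>1 - cos\<close>, replaces the uniform convergence theorem
  for regularly varying functions in the proof of \<open>V(V\<^sup>-(u)) \<sim> u\<close>. The limit theorem applied to
  \<open>F\<^sub>t(y) = exp (i \<langle>x, y\<rangle>)\<close> shows that the limit of the densities is a density with the required transform;
  its uniqueness is the uniqueness theorem for Fourier transforms.
\<close>

section \<open>Gaussian kernels on Euclidean space\<close>

text \<open>
  Lebesgue measure on a Euclidean space is the image of a product of Lebesgue measures on the line, so
  functions of product form can be integrated coordinate by coordinate.
\<close>

lemma lborel_integral_prod: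
  fixes f :: "'a::euclidean_space \<Rightarrow> real \<Rightarrow> 'b::{real_normed_field,banach,second_countable_topology}"
  assumes "\<And>b. b \<in> Basis \<Longrightarrow> integrable lborel (f b)"
  shows "integrable lborel (\<lambda>x::'a. \<Prod>b\<in>Basis. f b (x \<bullet> b))"
    and "(LINT x|lborel. (\<Prod>b\<in>Basis. f b (x \<bullet> b))) = (\<Prod>b\<in>(Basis::'a set). LINT u|lborel. f b u)"
proof -
  interpret product_sigma_finite "\<lambda>_::'a. lborel :: real measure" ..
  let ?T = "\<lambda>h. \<Sum>b\<in>Basis. h b *\<^sub>R (b::'a)"
  have T[measurable]: "?T \<in> measurable (\<Pi>\<^sub>M b\<in>Basis. lborel) borel"
    by measurable
  have [measurable]: "f b \<in> borel_measurable borel" if "b \<in> Basis" for b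
    using assms[OF that] by (simp add: borel_measurable_integrable)
  have m: "(\<lambda>x::'a. \<Prod>b\<in>Basis. f b (x \<bullet> b)) \<in> borel_measurable borel"
    by measurable
  have eq: "(\<Prod>b\<in>Basis. f b (?T h \<bullet> b)) = (\<Prod>b\<in>Basis. f b (h b))" for h
    by (intro prod.cong refl) simp
  show "integrable lborel (\<lambda>x::'a. \<Prod>b\<in>Basis. f b (x \<bullet> b))"
    unfolding lborel_eq[where 'a='a]
    by (subst integrable_distr_eq[OF T m]) (simp only: eq, intro product_integrable_prod assms, auto)
  show "(LINT x|lborel. (\<Prod>b\<in>Basis. f b (x \<bullet> b))) = (\<Prod>b\<in>(Basis::'a set). LINT u|lborel. f b u)"
    unfolding lborel_eq[where 'a='a]
    by (subst integral_distr[OF T m]) (simp only: eq, intro product_integral_prod assms, auto)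
qed

definition gauss :: "'a::euclidean_space \<Rightarrow> real" where
  "gauss x = (\<Prod>b\<in>Basis. std_normal_density (x \<bullet> b))"

lemma gauss_measurable[measurable]: "gauss \<in> borel_measurable borel"
  unfolding gauss_def[abs_def] by measurable

lemma continuous_on_gauss: "continuous_on A gauss"
  unfolding gauss_def[abs_def] std_normal_density_def by (intro continuous_intros) auto

lemma gauss_nonneg[simp]: "0 \<le> gauss x"
  unfolding gauss_def by (intro prod_nonneg) auto

lemma gauss_integrable: "integrable lborel (gauss :: 'a::euclidean_space \<Rightarrow> real)"
  unfolding gauss_def[abs_def]
  by (rule lborel_integral_prod) simp

lemma std_normal_density_le: "std_normal_density x \<le> 1 / sqrt (2 * pi)"
  unfolding std_normal_density_def by (auto simp: field_simps)

lemma gauss_le: "gauss (x::'a::euclidean_space) \<le> (1 / sqrt (2 * pi)) ^ DIM('a)"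
  unfolding gauss_def using prod_mono[of Basis "\<lambda>b. std_normal_density (x \<bullet> b)" "\<lambda>_. 1 / sqrt (2*pi)"]
  by (auto simp: std_normal_density_le power_divide)

lemma gauss_0: "gauss (0::'a::euclidean_space) = (1 / sqrt (2 * pi)) ^ DIM('a)"
  by (simp add: gauss_def std_normal_density_def power_divide)

lemma gauss_integral: "(LINT x|lborel. gauss (x::'a::euclidean_space)) = 1"
  unfolding gauss_def[abs_def]
  by (subst lborel_integral_prod) auto

lemma gauss_nn_integral: "(\<integral>\<^sup>+x. ennreal (gauss (x::'a::euclidean_space)) \<partial>lborel) = 1"
  using nn_integral_eq_integral[OF gauss_integrable] by (simp add: gauss_integral)

lemma std_normal_fourier:
  "(CLINT u|lborel. iexp (t * u) * complex_of_real (std_normal_density u))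
     = complex_of_real (sqrt (2 * pi) * std_normal_density t)"
proof -
  have "complex_of_real (exp (- (t\<^sup>2) / 2)) = char std_normal_distribution t"
    by (simp add: char_std_normal_distribution)
  also have "\<dots> = (CLINT u|lborel. std_normal_density u *\<^sub>R iexp (t * u))"
    unfolding char_def by (subst integral_density) auto
  also have "\<dots> = (CLINT u|lborel. iexp (t * u) * complex_of_real (std_normal_density u))"
    by (simp add: scaleR_conv_of_real mult.commute)
  finally show ?thesis
    by (simp add: std_normal_density_def)
qed

text \<open>
  Up to a constant the Gaussian is its own Fourier transform. This is the only explicit transform that is
  needed: it writes a Gaussian average of a measure as an integral against the transform of the measure.
\<close>

lemma gauss_fourier:
  fixes x :: "'a::euclidean_space"
  shows "(CLINT z|lborel. iexp (x \<bullet> z) * complex_of_real (gauss z))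
     = complex_of_real (sqrt (2 * pi) ^ DIM('a) * gauss x)"
proof -
  have "(CLINT z|lborel. iexp (x \<bullet> z) * complex_of_real (gauss z))
      = (CLINT z|lborel. \<Prod>b\<in>Basis. iexp ((x \<bullet> b) * (z \<bullet> b)) * complex_of_real (std_normal_density (z \<bullet> b)))"
    by (subst (1) euclidean_inner)
      (simp add: gauss_def prod.distrib exp_sum sum_distrib_left)
  also have "\<dots> = (\<Prod>b\<in>(Basis::'a set). complex_of_real (sqrt (2 * pi) * std_normal_density (x \<bullet> b)))"
  proof (subst lborel_integral_prod(2)[where f="\<lambda>b u. iexp ((x \<bullet> b) * u) * complex_of_real (std_normal_density u)"])
    fix b :: 'a
    show "integrable lborel (\<lambda>u. iexp ((x \<bullet> b) * u) * complex_of_real (std_normal_density u))"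
      by (rule Bochner_Integration.integrable_bound[of _ std_normal_density]) (auto simp: norm_mult)
  qed (simp only: std_normal_fourier)
  finally show ?thesis
    by (simp add: gauss_def prod.distrib)
qed

lemma nn_integral_lborel_affine:
  fixes f :: "'a::euclidean_space \<Rightarrow> ennreal"
  assumes [measurable]: "f \<in> borel_measurable borel" and c: "c \<noteq> 0"
  shows "(\<integral>\<^sup>+x. f x \<partial>lborel) = ennreal (\<bar>c\<bar> ^ DIM('a)) * (\<integral>\<^sup>+x. f (t + c *\<^sub>R x) \<partial>lborel)"
  by (subst lborel_affine[OF c, of t])
    (simp add: nn_integral_density nn_integral_distr nn_integral_cmult)

lemma integral_lborel_scale:
  fixes f :: "'a::euclidean_space \<Rightarrow> complex"
  assumes [measurable]: "f \<in> borel_measurable borel" and c: "c \<noteq> 0"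
  shows "(LINT x|lborel. f x) = complex_of_real (\<bar>c\<bar> ^ DIM('a)) * (LINT x|lborel. f (c *\<^sub>R x))"
  by (subst lborel_affine[OF c, of 0])
    (simp add: integral_density integral_distr scaleR_conv_of_real)

text \<open>
  Replace the Gaussian kernel by its Fourier representation and exchange the integrals: the Gaussian
  smoothing of \<open>M\<close> then depends on \<open>M\<close> only through \<open>\<phi>\<close>, and the smoothing parameter appears as the
  convergence factor \<open>gauss (s *\<^sub>R z)\<close> in the inversion integral.
\<close>

lemma fourier_smoothing:
  fixes M :: "'a::euclidean_space measure"
  assumes fin: "finite_measure M" and sets[measurable_cong]: "sets M = sets borel" and s: "0 < s"
    and phi: "\<And>x. \<phi> x = (CLINT y|M. iexp (x \<bullet> y))"
  shows "complex_of_real (LINT y|M. gauss ((x - y) /\<^sub>R s)) =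
    complex_of_real ((s / sqrt (2 * pi)) ^ DIM('a)) *
      (CLINT z|lborel. complex_of_real (gauss (s *\<^sub>R z)) * iexp (- (z \<bullet> x)) * \<phi> z)"
proof -
  interpret M: finite_measure M by fact
  interpret pair_sigma_finite "lborel :: 'a measure" M ..
  let ?K = "complex_of_real (sqrt (2 * pi) ^ DIM('a))"
  have [measurable]: "\<phi> \<in> borel_measurable borel"
  proof -
    have "(\<lambda>x. CLINT y|M. iexp (x \<bullet> y)) \<in> borel_measurable borel"
      by (rule M.borel_measurable_lebesgue_integral) measurable
    then show ?thesis unfolding phi .
  qed
  let ?f = "\<lambda>z y. iexp (((x - y) /\<^sub>R s) \<bullet> z) * complex_of_real (gauss z)"
  have int: "integrable (lborel \<Otimes>\<^sub>M M) (case_prod ?f)"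
  proof (rule Fubini_integrable)
    show "case_prod ?f \<in> borel_measurable (lborel \<Otimes>\<^sub>M M)" by measurable
    show "integrable lborel (\<lambda>z. LINT y|M. norm (case (z, y) of (z, y) \<Rightarrow> ?f z y))"
      by (simp add: norm_mult gauss_integrable)
    show "AE z in lborel. integrable M (\<lambda>y. case (z, y) of (z, y) \<Rightarrow> ?f z y)"
      by (intro AE_I2 M.integrable_const_bound[of _ "gauss _"]) (auto simp: norm_mult)
  qed
  have "?K * complex_of_real (LINT y|M. gauss ((x - y) /\<^sub>R s)) = (CLINT y|M. (CLINT z|lborel. ?f z y))"
    by (simp only: gauss_fourier of_real_mult integral_mult_right_zero integral_complex_of_real)
  also have "\<dots> = (CLINT z|lborel. (CLINT y|M. ?f z y))"
    by (rule Fubini_integral[OF int])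
  also have "\<dots> = (CLINT z|lborel. complex_of_real (gauss z) * iexp (z \<bullet> (x /\<^sub>R s)) * \<phi> (- z /\<^sub>R s))"
  proof (intro Bochner_Integration.integral_cong refl)
    fix z :: 'a
    have "?f z y = (complex_of_real (gauss z) * iexp (z \<bullet> (x /\<^sub>R s))) * iexp ((- z /\<^sub>R s) \<bullet> y)" for y
      by (simp add: exp_add[symmetric] inner_diff_left inner_commute algebra_simps)
    then show "(CLINT y|M. ?f z y) = complex_of_real (gauss z) * iexp (z \<bullet> (x /\<^sub>R s)) * \<phi> (- z /\<^sub>R s)"
      by (simp only: integral_mult_right_zero phi)
  qed
  also have "\<dots> = complex_of_real (s ^ DIM('a)) *
      (CLINT z|lborel. complex_of_real (gauss (s *\<^sub>R z)) * iexp (- (z \<bullet> x)) * \<phi> z)"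
  proof -
    have g: "gauss (- u) = gauss u" for u :: 'a by (simp add: gauss_def std_normal_density_def)
    show ?thesis
      using s by (subst integral_lborel_scale[where c="-s"]) (auto simp: g mult.assoc[symmetric])
  qed
  finally have *: "?K * complex_of_real (LINT y|M. gauss ((x - y) /\<^sub>R s)) = complex_of_real (s ^ DIM('a)) *
      (CLINT z|lborel. complex_of_real (gauss (s *\<^sub>R z)) * iexp (- (z \<bullet> x)) * \<phi> z)" .
  have "complex_of_real (LINT y|M. gauss ((x - y) /\<^sub>R s)) =
      (?K * complex_of_real (LINT y|M. gauss ((x - y) /\<^sub>R s))) / ?K"
    by simp
  then show ?thesis
    unfolding * by (simp add: power_divide)
qed

section \<open>Uniqueness and inversion for Fourier transforms of finite measures\<close>

text \<open>
  The indicator of a bounded open set is an increasing limit of truncated multiples of the distance to the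
  complement, and the bounded open sets form an intersection-stable generator of the Borel sets.
  Only one of the two measures is required to be finite, so that the other one may be given by a density
  whose total mass is not yet known.
\<close>

lemma measure_eqI_bump_functions:
  fixes M N :: "'a::euclidean_space measure"
  assumes fin: "finite_measure M" and sM[measurable_cong]: "sets M = sets borel"
    and sN[measurable_cong]: "sets N = sets borel"
    and eq: "\<And>f :: 'a \<Rightarrow> real. continuous_on UNIV f \<Longrightarrow> (\<And>x. 0 \<le> f x) \<Longrightarrow> (\<And>x. f x \<le> 1) \<Longrightarrow>
        bounded {x. f x \<noteq> 0} \<Longrightarrow> (\<integral>\<^sup>+x. ennreal (f x) \<partial>M) = (\<integral>\<^sup>+x. ennreal (f x) \<partial>N)"
  shows "M = N"
proof (rule measure_eqI_generator_eq[where E="{U. open U \<and> bounded U}" and \<Omega>=UNIV and A="\<lambda>n::nat. ball 0 n"])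
  interpret M: finite_measure M by fact
  show "Int_stable {U::'a set. open U \<and> bounded U}"
    by (auto simp: Int_stable_def intro: bounded_Int)
  have "sigma_sets UNIV {U::'a set. open U \<and> bounded U} = sets borel"
  proof (intro antisym)
    show "sigma_sets UNIV {U::'a set. open U \<and> bounded U} \<subseteq> sets borel"
    proof -
      have "{U::'a set. open U \<and> bounded U} \<subseteq> sets borel" by auto
      then show ?thesis using sets.sigma_sets_subset[of _ "borel :: 'a measure"] by simp
    qed
    have "U \<in> sigma_sets UNIV {U. open U \<and> bounded U}" if "open U" for U :: "'a set"
    proof -
      have "(\<Union>n::nat. U \<inter> ball 0 n) \<in> sigma_sets UNIV {U::'a set. open U \<and> bounded U}"
        using that by (intro sigma_sets.Union sigma_sets.Basic) auto
      moreover have "(\<Union>n::nat. U \<inter> ball 0 n) = U"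
        using reals_Archimedean2 by fastforce
      ultimately show ?thesis by simp
    qed
    then show "sets borel \<subseteq> sigma_sets UNIV {U::'a set. open U \<and> bounded U}"
      unfolding borel_def by (subst sets_measure_of) (auto intro!: sigma_sets_mono)
  qed
  then show "sets M = sigma_sets UNIV {U. open U \<and> bounded U}" "sets N = sigma_sets UNIV {U. open U \<and> bounded U}"
    using sM sN by auto
  show "(\<Union>i::nat. ball (0::'a) i) = UNIV"
    using reals_Archimedean2 by fastforce
  show "emeasure M (ball 0 (real i)) \<noteq> \<infinity>" for i :: nat
    by simp
  fix U :: "'a set" assume "U \<in> {U. open U \<and> bounded U}"
  then have U: "open U" "bounded U" by auto
  then have "U \<noteq> UNIV" by auto
  then have ne: "- U \<noteq> {}" by auto
  define f where "f n x = min 1 (real n * infdist x (- U))" for n :: nat and x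
  have f0: "f n x = 0" if "x \<notin> U" for n x
    using that by (simp add: f_def infdist_zero)
  have pos: "0 < infdist x (- U)" if "x \<in> U" for x
    using that U ne by (metis ComplD closed_Compl in_closed_iff_infdist_zero infdist_nonneg less_eq_real_def)
  have ind: "(SUP n. ennreal (f n x)) = indicator U x" for x
  proof (cases "x \<in> U")
    case True
    have "(\<lambda>n. f n x) \<longlonglongrightarrow> 1"
    proof (rule tendsto_eventually)
      obtain n0 where "1 / infdist x (- U) < real n0" using reals_Archimedean2 by blast
      then show "\<forall>\<^sub>F n in sequentially. f n x = 1"
        using pos[OF True]
        by (intro eventually_sequentiallyI[of n0]) (simp add: f_def min_def field_simps, smt (verit) mult_right_mono of_nat_le_iff)
    qed
    then have "(\<lambda>n. ennreal (f n x)) \<longlonglongrightarrow> ennreal 1" by (intro tendsto_ennrealI)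
    moreover have "(\<lambda>n. ennreal (f n x)) \<longlonglongrightarrow> (SUP n. ennreal (f n x))"
      by (rule LIMSEQ_SUP) (auto simp: incseq_def f_def intro!: ennreal_leI min.mono mult_right_mono infdist_nonneg)
    ultimately show ?thesis using True LIMSEQ_unique by force
  qed (simp add: f0)
  have cont: "continuous_on UNIV (f n)" for n
    unfolding f_def[abs_def] by (intro continuous_intros)
  have [measurable]: "f n \<in> borel_measurable borel" for n
    using cont by (rule borel_measurable_continuous_onI)
  have em: "emeasure K U = (SUP n. \<integral>\<^sup>+x. ennreal (f n x) \<partial>K)" if [measurable_cong]: "sets K = sets borel" for K
  proof -
    have "emeasure K U = (\<integral>\<^sup>+x. (SUP n. ennreal (f n x)) \<partial>K)"
      using U that by (simp add: ind)
    also have "\<dots> = (SUP n. \<integral>\<^sup>+x. ennreal (f n x) \<partial>K)"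
    proof (rule nn_integral_monotone_convergence_SUP)
      show "incseq (\<lambda>n x. ennreal (f n x))"
        by (auto simp: incseq_def f_def le_fun_def intro!: ennreal_leI min.mono mult_right_mono infdist_nonneg)
    qed measurable
    finally show ?thesis .
  qed
  show "emeasure M U = emeasure N U"
    unfolding em[OF sM] em[OF sN]
  proof (intro SUP_cong refl eq cont)
    show "bounded {x. f n x \<noteq> 0}" for n
      by (rule bounded_subset[OF U(2)]) (use f0 in auto)
  qed (auto simp: f_def infdist_nonneg)
qed auto

text \<open>
  By Fubini's theorem and the substitution \<open>x = y + s z\<close>, the integral of \<open>f\<close> against the smoothed measure is
  the integral of \<open>\<integral> f (y + s z) gauss z dz\<close> against \<open>M\<close>, which converges to \<open>f y\<close> boundedly.
\<close>

lemma gaussian_regularization_tendsto: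
  fixes M :: "'a::euclidean_space measure" and f :: "'a \<Rightarrow> real"
  assumes fin: "finite_measure M" and sets[measurable_cong]: "sets M = sets borel"
    and f: "continuous_on UNIV f" "\<And>x. 0 \<le> f x" "\<And>x. f x \<le> 1"
    and s: "\<And>n. 0 < s n" "s \<longlonglongrightarrow> 0"
  shows "(\<lambda>n. \<integral>\<^sup>+x. ennreal (f x * ((LINT y|M. gauss ((x - y) /\<^sub>R s n)) / s n ^ DIM('a))) \<partial>lborel)
    \<longlonglongrightarrow> (\<integral>\<^sup>+x. ennreal (f x) \<partial>M)"
proof -
  interpret M: finite_measure M by fact
  interpret pair_sigma_finite "lborel :: 'a measure" M ..
  have [measurable]: "f \<in> borel_measurable borel"
    using f(1) by (rule borel_measurable_continuous_onI)
  have eq: "(\<integral>\<^sup>+x. ennreal (f x * ((LINT y|M. gauss ((x - y) /\<^sub>R s n)) / s n ^ DIM('a))) \<partial>lborel)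
    = (\<integral>\<^sup>+y. \<integral>\<^sup>+z. ennreal (f (y + s n *\<^sub>R z) * gauss z) \<partial>lborel \<partial>M)" for n
  proof -
    have s0: "0 < s n" by (rule s)
    have "(\<integral>\<^sup>+x. ennreal (f x * ((LINT y|M. gauss ((x - y) /\<^sub>R s n)) / s n ^ DIM('a))) \<partial>lborel)
       = (\<integral>\<^sup>+x. \<integral>\<^sup>+y. ennreal (f x * gauss ((x - y) /\<^sub>R s n) / s n ^ DIM('a)) \<partial>M \<partial>lborel)"
    proof (intro nn_integral_cong)
      fix x :: 'a
      have "(\<integral>\<^sup>+y. ennreal (f x * gauss ((x - y) /\<^sub>R s n) / s n ^ DIM('a)) \<partial>M)
        = ennreal (LINT y|M. f x * gauss ((x - y) /\<^sub>R s n) / s n ^ DIM('a))"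
        using f s0
        by (intro nn_integral_eq_integral M.integrable_const_bound[of _ "(1 / sqrt (2 * pi)) ^ DIM('a) / s n ^ DIM('a)"] AE_I2)
          (auto simp: abs_mult power_abs abs_of_pos intro!: divide_right_mono order_trans[OF mult_left_le_one_le gauss_le])
      then show "ennreal (f x * ((LINT y|M. gauss ((x - y) /\<^sub>R s n)) / s n ^ DIM('a)))
        = (\<integral>\<^sup>+y. ennreal (f x * gauss ((x - y) /\<^sub>R s n) / s n ^ DIM('a)) \<partial>M)"
        by simp
    qed
    also have "\<dots> = (\<integral>\<^sup>+y. \<integral>\<^sup>+x. ennreal (f x * gauss ((x - y) /\<^sub>R s n) / s n ^ DIM('a)) \<partial>lborel \<partial>M)"
      by (rule Fubini'[symmetric]) measurable
    also have "\<dots> = (\<integral>\<^sup>+y. \<integral>\<^sup>+z. ennreal (f (y + s n *\<^sub>R z) * gauss z) \<partial>lborel \<partial>M)"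
    proof (rule nn_integral_cong)
      fix y :: 'a
      show "(\<integral>\<^sup>+x. ennreal (f x * gauss ((x - y) /\<^sub>R s n) / s n ^ DIM('a)) \<partial>lborel)
        = (\<integral>\<^sup>+z. ennreal (f (y + s n *\<^sub>R z) * gauss z) \<partial>lborel)"
        using s0
        by (subst nn_integral_lborel_affine[where c="s n" and t=y])
          (auto simp: nn_integral_cmult[symmetric] ennreal_mult'[symmetric] f(2))
    qed
    finally show ?thesis .
  qed
  have inner: "(\<lambda>n. \<integral>\<^sup>+z. ennreal (f (y + s n *\<^sub>R z) * gauss z) \<partial>lborel) \<longlonglongrightarrow> ennreal (f y)" for y
  proof -
    have "(\<lambda>n. \<integral>\<^sup>+z. ennreal (f (y + s n *\<^sub>R z) * gauss z) \<partial>lborel) \<longlonglongrightarrow> (\<integral>\<^sup>+z. ennreal (f y * gauss (z::'a)) \<partial>lborel)"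
    proof (rule nn_integral_dominated_convergence[where w="\<lambda>z::'a. ennreal (gauss z)"])
      show "AE z in lborel. ennreal (f (y + s n *\<^sub>R z) * gauss z) \<le> ennreal (gauss z)" for n
        using f by (auto intro!: AE_I2 ennreal_leI mult_left_le_one_le)
      show "AE z in lborel. (\<lambda>n. ennreal (f (y + s n *\<^sub>R z) * gauss z)) \<longlonglongrightarrow> ennreal (f y * gauss z)"
      proof (intro AE_I2 tendsto_ennrealI tendsto_mult tendsto_const)
        fix z :: 'a
        have "(\<lambda>n. y + s n *\<^sub>R z) \<longlonglongrightarrow> y + 0 *\<^sub>R z"
          by (intro tendsto_intros s)
        then show "(\<lambda>n. f (y + s n *\<^sub>R z)) \<longlonglongrightarrow> f y"
          using continuous_on_tendsto_compose[OF f(1)] by force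
      qed
    qed (auto simp: gauss_nn_integral)
    also have "(\<integral>\<^sup>+z. ennreal (f y * gauss (z::'a)) \<partial>lborel) = ennreal (f y)"
      by (simp add: ennreal_mult' f(2) nn_integral_cmult gauss_nn_integral)
    finally show ?thesis .
  qed
  show ?thesis
    unfolding eq
  proof (rule nn_integral_dominated_convergence[where w="\<lambda>_. 1"])
    show "AE y in M. (\<integral>\<^sup>+z. ennreal (f (y + s n *\<^sub>R z) * gauss z) \<partial>lborel) \<le> 1" for n
    proof (intro AE_I2)
      fix y :: 'a
      have "(\<integral>\<^sup>+z. ennreal (f (y + s n *\<^sub>R z) * gauss z) \<partial>lborel) \<le> (\<integral>\<^sup>+z. ennreal (gauss (z::'a)) \<partial>lborel)"
        using f by (auto intro!: nn_integral_mono ennreal_leI mult_left_le_one_le)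
      then show "(\<integral>\<^sup>+z. ennreal (f (y + s n *\<^sub>R z) * gauss z) \<partial>lborel) \<le> 1"
        by (simp add: gauss_nn_integral)
    qed
    show "(\<integral>\<^sup>+ x. 1 \<partial>M) < \<infinity>"
      by (simp add: M.emeasure_finite less_top[symmetric])
  qed (auto simp: inner)
qed

text \<open>
  Equal transforms give equal Gaussian smoothings, and the measures are recovered from these.
\<close>

lemma measure_eqI_fourier:
  fixes M N :: "'a::euclidean_space measure"
  assumes M: "finite_measure M" "sets M = sets borel" and N: "finite_measure N" "sets N = sets borel"
    and eq: "\<And>x. (CLINT y|M. iexp (x \<bullet> y)) = (CLINT y|N. iexp (x \<bullet> y))"
  shows "M = N"
proof (rule measure_eqI_bump_functions[OF M N(2)])
  fix f :: "'a \<Rightarrow> real"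
  assume f: "continuous_on UNIV f" "\<And>x. 0 \<le> f x" "\<And>x. f x \<le> 1"
  let ?s = "\<lambda>n. inverse (real (Suc n))"
  have s: "0 < ?s n" "?s \<longlonglongrightarrow> 0" for n
    by (auto intro: LIMSEQ_inverse_real_of_nat simp del: of_nat_Suc)
  have "complex_of_real (LINT y|M. gauss ((x - y) /\<^sub>R ?s n)) = complex_of_real (LINT y|N. gauss ((x - y) /\<^sub>R ?s n))" for x n
    unfolding fourier_smoothing[OF M s(1) refl] fourier_smoothing[OF N s(1) refl] eq ..
  then have "(LINT y|M. gauss ((x - y) /\<^sub>R ?s n)) = (LINT y|N. gauss ((x - y) /\<^sub>R ?s n))" for x n
    using of_real_eq_iff by blast
  with gaussian_regularization_tendsto[OF M f s] gaussian_regularization_tendsto[OF N f s]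
  show "(\<integral>\<^sup>+x. ennreal (f x) \<partial>M) = (\<integral>\<^sup>+x. ennreal (f x) \<partial>N)"
    by (auto intro: LIMSEQ_unique)
qed

text \<open>
  The real part makes the candidate density a real function for every \<open>\<phi>\<close>; for the transform of a measure
  the integral is real anyway.
\<close>

definition fourier_density :: "('a::euclidean_space \<Rightarrow> complex) \<Rightarrow> 'a \<Rightarrow> real" where
  "fourier_density \<phi> x = Re (CLINT z|lborel. iexp (- (z \<bullet> x)) * \<phi> z) / (2 * pi) ^ DIM('a)"

lemma fourier_density_measurable[measurable]:
  assumes [measurable]: "\<phi> \<in> borel_measurable borel"
  shows "fourier_density \<phi> \<in> borel_measurable borel"
proof -
  have [measurable]: "(\<lambda>x. CLINT z|lborel. iexp (- (z \<bullet> x)) * \<phi> z) \<in> borel_measurable borel"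
    by (rule lborel.borel_measurable_lebesgue_integral) measurable
  show ?thesis unfolding fourier_density_def[abs_def] by measurable
qed

lemma abs_fourier_density_le:
  fixes \<phi> :: "'a::euclidean_space \<Rightarrow> complex"
  assumes "integrable lborel \<phi>"
  shows "\<bar>fourier_density \<phi> x\<bar> \<le> (LINT z|lborel. norm (\<phi> z)) / (2 * pi) ^ DIM('a)"
proof -
  have "\<bar>Re (CLINT z|lborel. iexp (- (z \<bullet> x)) * \<phi> z)\<bar> \<le> norm (CLINT z|lborel. iexp (- (z \<bullet> x)) * \<phi> z)"
    by (rule abs_Re_le_cmod)
  also have "\<dots> \<le> (LINT z|lborel. norm (\<phi> z))"
    using integral_norm_bound[of lborel "\<lambda>z. iexp (- (z \<bullet> x)) * \<phi> z"] by (simp add: norm_mult)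
  finally show ?thesis
    unfolding fourier_density_def by (simp add: abs_divide divide_right_mono)
qed

text \<open>
  The Gaussian smoothings of \<open>M\<close> have densities that converge pointwise to \<open>fourier_density \<phi>\<close>, because the
  convergence factor in the inversion integral tends to a constant and \<open>\<phi>\<close> is integrable; they are also uniformly
  bounded. Hence their integrals against a bump function converge both to its integral against \<open>M\<close>
  and to its integral against \<open>fourier_density \<phi>\<close>. Nonnegativity passes to the limit.
\<close>

theorem fourier_inversion:
  fixes M :: "'a::euclidean_space measure"
  assumes fin: "finite_measure M" and sets[measurable_cong]: "sets M = sets borel"
    and phi: "\<And>x. \<phi> x = (CLINT y|M. iexp (x \<bullet> y))"
    and int: "integrable lborel \<phi>"
  shows "0 \<le> fourier_density \<phi> x" "M = density lborel (\<lambda>x. ennreal (fourier_density \<phi> x))"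
proof -
  interpret M: finite_measure M by fact
  let ?s = "\<lambda>n. inverse (real (Suc n))"
  have s: "0 < ?s n" "?s \<longlonglongrightarrow> 0" for n
    by (auto intro: LIMSEQ_inverse_real_of_nat simp del: of_nat_Suc)
  let ?S = "\<lambda>n x. (LINT y|M. gauss ((x - y) /\<^sub>R ?s n)) / ?s n ^ DIM('a)"
  let ?I = "\<lambda>n x. CLINT z|lborel. complex_of_real (gauss (?s n *\<^sub>R z)) * iexp (- (z \<bullet> x)) * \<phi> z"
  let ?k = "(1 / sqrt (2 * pi)) ^ DIM('a)"
  have kk: "?k * ?k = 1 / (2 * pi) ^ DIM('a)"
  proof -
    have "?k * ?k = (1 / sqrt (2 * pi) * (1 / sqrt (2 * pi))) ^ DIM('a)"
      by (simp only: power_mult_distrib)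
    also have "1 / sqrt (2 * pi) * (1 / sqrt (2 * pi)) = 1 / (2 * pi)"
      by simp
    finally show ?thesis by (simp add: power_one_over)
  qed
  have [measurable]: "\<phi> \<in> borel_measurable borel"
    using int by (simp add: borel_measurable_integrable)
  have S: "?S n x = ?k * Re (?I n x)" for n x
  proof -
    have scale: "Re (complex_of_real ((a / sqrt (2 * pi)) ^ DIM('a)) * w) / a ^ DIM('a) = ?k * Re w"
      if "0 < a" for a w
      using that by (simp add: power_divide)
    have "?S n x = Re (complex_of_real (LINT y|M. gauss ((x - y) /\<^sub>R ?s n))) / ?s n ^ DIM('a)"
      by (simp only: Re_complex_of_real)
    also have "\<dots> = ?k * Re (?I n x)"
      unfolding fourier_smoothing[OF fin sets s(1) phi] by (rule scale[OF s(1)])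
    finally show ?thesis .
  qed
  have lim: "(\<lambda>n. ?S n x) \<longlonglongrightarrow> fourier_density \<phi> x" for x
  proof -
    have "(\<lambda>n. ?I n x) \<longlonglongrightarrow> (CLINT z|lborel. complex_of_real ?k * iexp (- (z \<bullet> x)) * \<phi> z)"
    proof (rule integral_dominated_convergence[where w="\<lambda>z. ?k * norm (\<phi> z)"])
      show "AE z in lborel. (\<lambda>n. complex_of_real (gauss (?s n *\<^sub>R z)) * iexp (- (z \<bullet> x)) * \<phi> z)
          \<longlonglongrightarrow> complex_of_real ?k * iexp (- (z \<bullet> x)) * \<phi> z"
      proof (intro AE_I2 tendsto_mult tendsto_const tendsto_of_real)
        fix z :: 'a
        have "(\<lambda>n. ?s n *\<^sub>R z) \<longlonglongrightarrow> 0 *\<^sub>R z" by (intro tendsto_intros s)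
        then show "(\<lambda>n. gauss (?s n *\<^sub>R z)) \<longlonglongrightarrow> ?k"
          using continuous_on_tendsto_compose[OF continuous_on_gauss[of UNIV]] by (force simp: gauss_0)
      qed
      show "AE z in lborel. norm (complex_of_real (gauss (?s n *\<^sub>R z)) * iexp (- (z \<bullet> x)) * \<phi> z) \<le> ?k * norm (\<phi> z)" for n
        by (intro AE_I2) (simp add: norm_mult mult_right_mono gauss_le del: power_one_over of_nat_Suc)
      show "integrable lborel (\<lambda>z. ?k * norm (\<phi> z))"
        using int by (intro integrable_mult_right integrable_norm)
    qed measurable
    then have "(\<lambda>n. ?k * Re (?I n x)) \<longlonglongrightarrow> ?k * Re (CLINT z|lborel. complex_of_real ?k * iexp (- (z \<bullet> x)) * \<phi> z)"
      by (intro tendsto_intros)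
    also have "?k * Re (CLINT z|lborel. complex_of_real ?k * iexp (- (z \<bullet> x)) * \<phi> z) = (?k * ?k) * Re (CLINT z|lborel. iexp (- (z \<bullet> x)) * \<phi> z)"
      by (simp only: mult.assoc integral_mult_right_zero Re_complex_of_real Im_complex_of_real times_complex.sel) simp
    finally show ?thesis
      unfolding S fourier_density_def kk by simp
  qed
  have S0: "0 \<le> ?S n x" for n x
    by (intro divide_nonneg_nonneg integral_nonneg) (auto simp del: of_nat_Suc)
  show nn: "0 \<le> fourier_density \<phi> x" for x
    by (rule LIMSEQ_le_const[OF lim]) (use S0 in auto)
  show "M = density lborel (\<lambda>x. ennreal (fourier_density \<phi> x))"
  proof (rule measure_eqI_bump_functions[OF fin sets])
    fix f :: "'a \<Rightarrow> real"
    assume f: "continuous_on UNIV f" "\<And>x. 0 \<le> f x" "\<And>x. f x \<le> 1" and bd: "bounded {x. f x \<noteq> 0}"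
    have [measurable]: "f \<in> borel_measurable borel"
      using f(1) by (rule borel_measurable_continuous_onI)
    have [measurable]: "?S n \<in> borel_measurable borel" for n
    proof -
      have [measurable]: "(\<lambda>x. LINT y|M. gauss ((x - y) /\<^sub>R ?s n)) \<in> borel_measurable borel"
        by (rule M.borel_measurable_lebesgue_integral) measurable
      show ?thesis by measurable
    qed
    define B where "B = ?k * (?k * (LINT z|lborel. norm (\<phi> z)))"
    have B0: "0 \<le> B" unfolding B_def by (intro mult_nonneg_nonneg integral_nonneg) auto
    have SB: "?S n x \<le> B" for n x
    proof -
      have "Re (?I n x) \<le> norm (?I n x)" by (rule complex_Re_le_cmod)
      also have "\<dots> \<le> (LINT z|lborel. ?k * norm (\<phi> z))"
      proof (rule Bochner_Integration.integral_norm_bound_integral)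
        show i: "integrable lborel (\<lambda>z. ?k * norm (\<phi> z))"
          using int by (intro integrable_mult_right integrable_norm)
        show b: "norm (complex_of_real (gauss (?s n *\<^sub>R z)) * iexp (- (z \<bullet> x)) * \<phi> z) \<le> ?k * norm (\<phi> z)" for z
          by (simp add: norm_mult mult_right_mono gauss_le del: power_one_over of_nat_Suc)
        show "integrable lborel (\<lambda>z. complex_of_real (gauss (?s n *\<^sub>R z)) * iexp (- (z \<bullet> x)) * \<phi> z)"
          by (rule Bochner_Integration.integrable_bound[OF i]) (use b in \<open>auto intro!: AE_I2 order_trans[OF b] simp del: of_nat_Suc power_one_over\<close>)
      qed
      finally show ?thesis unfolding S B_def by (intro mult_left_mono) auto
    qed
    obtain r where r: "{x. f x \<noteq> 0} \<subseteq> ball 0 r" using bd bounded_subset_ballD by blast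
    have [measurable]: "ball (0::'a) r \<in> sets borel" by simp
    have "(\<lambda>n. \<integral>\<^sup>+x. ennreal (f x * ?S n x) \<partial>lborel) \<longlonglongrightarrow> (\<integral>\<^sup>+x. ennreal (f x * fourier_density \<phi> x) \<partial>lborel)"
    proof (rule nn_integral_dominated_convergence[where w="\<lambda>x. ennreal B * indicator (ball 0 r) x"])
      show "AE x in lborel. (\<lambda>n. ennreal (f x * ?S n x)) \<longlonglongrightarrow> ennreal (f x * fourier_density \<phi> x)"
        by (intro AE_I2 tendsto_ennrealI tendsto_mult tendsto_const lim)
      show "AE x in lborel. ennreal (f x * ?S n x) \<le> ennreal B * indicator (ball 0 r) x" for n
      proof (intro AE_I2)
        fix x
        show "ennreal (f x * ?S n x) \<le> ennreal B * indicator (ball 0 r) x"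
        proof (cases "f x = 0")
          case False
          then have "x \<in> ball 0 r" using r by auto
          moreover have "f x * ?S n x \<le> B"
            using mult_left_le_one_le[OF S0 f(2) f(3)] SB order_trans by blast
          ultimately show ?thesis by (simp add: ennreal_leI)
        qed auto
      qed
      show "(\<integral>\<^sup>+ x. ennreal B * indicator (ball (0::'a) r) x \<partial>lborel) < \<infinity>"
        using emeasure_bounded_finite[of "ball (0::'a) r"] by (simp add: nn_integral_cmult_indicator ennreal_mult_less_top)
    qed measurable
    with gaussian_regularization_tendsto[OF fin sets f s]
    have "(\<integral>\<^sup>+x. ennreal (f x) \<partial>M) = (\<integral>\<^sup>+x. ennreal (f x * fourier_density \<phi> x) \<partial>lborel)"
      by (rule LIMSEQ_unique)
    also have "\<dots> = (\<integral>\<^sup>+x. ennreal (f x) \<partial>density lborel (\<lambda>x. ennreal (fourier_density \<phi> x)))"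
      by (subst nn_integral_density) (auto simp: ennreal_mult'[OF f(2)] nn mult.commute)
    finally show "(\<integral>\<^sup>+x. ennreal (f x) \<partial>M) = (\<integral>\<^sup>+x. ennreal (f x) \<partial>density lborel (\<lambda>x. ennreal (fourier_density \<phi> x)))" .
  qed auto
qed

section \<open>Limits of integrals with uniformly small tails\<close>

text \<open>
  Inside a ball the functions are bounded and dominated convergence applies; outside a large ball the
  integrals are small uniformly in \<open>n\<close>, and Fatou's lemma transfers this to the limit. The tails take the place
  of an integrable majorant, for use where truncated moments are all that can be controlled.
\<close>

lemma integral_tendsto_of_uniform_tails:
  fixes H :: "nat \<Rightarrow> 'a::euclidean_space \<Rightarrow> 'b::{banach,second_countable_topology}"
  assumes meas[measurable]: "\<And>n. H n \<in> borel_measurable borel"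
    and lim: "\<And>x. (\<lambda>n. H n x) \<longlonglongrightarrow> h x"
    and bdd: "\<And>r. \<exists>K. \<forall>n x. norm x \<le> r \<longrightarrow> norm (H n x) \<le> K"
    and tails: "\<And>\<epsilon>. 0 < \<epsilon> \<Longrightarrow> \<exists>r. \<forall>\<^sub>F n in sequentially.
      (\<integral>\<^sup>+x. ennreal (norm (H n x)) * indicator {x. r \<le> norm x} x \<partial>lborel) \<le> ennreal \<epsilon>"
  shows "integrable lborel h" "(\<lambda>n. LINT x|lborel. H n x) \<longlonglongrightarrow> (LINT x|lborel. h x)"
proof -
  have [measurable]: "h \<in> borel_measurable borel"
    by (rule borel_measurable_LIMSEQ_metric[OF meas lim])
  let ?I = "\<lambda>r x. indicat_real {x::'a. norm x < r} x"
  let ?J = "\<lambda>r x. indicator {x::'a. r \<le> norm x} x :: ennreal"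
  have inner: "integrable lborel (\<lambda>x. ?I r x *\<^sub>R h x)" "\<And>n. integrable lborel (\<lambda>x. ?I r x *\<^sub>R H n x)"
    "(\<lambda>n. LINT x|lborel. ?I r x *\<^sub>R H n x) \<longlonglongrightarrow> (LINT x|lborel. ?I r x *\<^sub>R h x)" for r
  proof -
    obtain K where K: "\<And>n x. norm x \<le> r \<Longrightarrow> norm (H n x) \<le> K" using bdd by blast
    let ?w = "\<lambda>x::'a. indicat_real (ball 0 r) x * K"
    have w: "integrable lborel ?w"
      using emeasure_bounded_finite[of "ball (0::'a) r"] by (intro integrable_mult_left integrable_real_indicator) auto
    have b: "AE x in lborel. norm (?I r x *\<^sub>R H n x) \<le> ?w x" for n
      using K by (intro AE_I2) (auto simp: indicator_def)
    have l: "AE x in lborel. (\<lambda>n. ?I r x *\<^sub>R H n x) \<longlonglongrightarrow> ?I r x *\<^sub>R h x"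
      by (intro AE_I2 tendsto_intros lim)
    have m: "(\<lambda>x. ?I r x *\<^sub>R h x) \<in> borel_measurable lborel" "\<And>n. (\<lambda>x. ?I r x *\<^sub>R H n x) \<in> borel_measurable lborel"
      by measurable
    show "integrable lborel (\<lambda>x. ?I r x *\<^sub>R h x)"
      by (rule integrable_dominated_convergence[OF m w l b])
    show "integrable lborel (\<lambda>x. ?I r x *\<^sub>R H n x)" for n
      by (rule integrable_dominated_convergence2[OF m w l b])
    show "(\<lambda>n. LINT x|lborel. ?I r x *\<^sub>R H n x) \<longlonglongrightarrow> (LINT x|lborel. ?I r x *\<^sub>R h x)"
      by (rule integral_dominated_convergence[OF m w l b])
  qed
  \<comment> \<open>A function whose tail integral is small is integrable, and its integral is
      close to that over the ball; this serves both the sequence and the limit.\<close>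
  have split_integrable: "integrable lborel k" "norm ((LINT x|lborel. k x) - (LINT x|lborel. ?I r x *\<^sub>R k x)) \<le> \<epsilon>"
    if [measurable]: "k \<in> borel_measurable borel" and i: "integrable lborel (\<lambda>x. ?I r x *\<^sub>R k x)"
      and t: "(\<integral>\<^sup>+x. ennreal (norm (k x)) * ?J r x \<partial>lborel) \<le> ennreal \<epsilon>" and e: "0 < \<epsilon>"
    for k :: "'a \<Rightarrow> 'b" and r \<epsilon>
  proof -
    let ?k = "\<lambda>x. (1 - ?I r x) *\<^sub>R k x"
    have nn: "(\<integral>\<^sup>+x. ennreal (norm (?k x)) \<partial>lborel) = (\<integral>\<^sup>+x. ennreal (norm (k x)) * ?J r x \<partial>lborel)"
      by (intro nn_integral_cong) (auto simp: indicator_def)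
    have j: "integrable lborel ?k"
    proof (rule integrableI_bounded)
      show "(\<integral>\<^sup>+x. ennreal (norm (?k x)) \<partial>lborel) < \<infinity>"
        unfolding nn using t ennreal_less_top[of \<epsilon>] by (simp add: order_le_less_trans)
    qed measurable
    have "integrable lborel (\<lambda>x. ?I r x *\<^sub>R k x + ?k x)"
      by (intro Bochner_Integration.integrable_add i j)
    then show k: "integrable lborel k" by (simp add: algebra_simps)
    have "(LINT x|lborel. k x) - (LINT x|lborel. ?I r x *\<^sub>R k x) = (LINT x|lborel. k x - ?I r x *\<^sub>R k x)"
      by (rule Bochner_Integration.integral_diff[symmetric, OF k i])
    also have "\<dots> = (LINT x|lborel. ?k x)" by (simp add: algebra_simps)
    finally have *: "(LINT x|lborel. k x) - (LINT x|lborel. ?I r x *\<^sub>R k x) = (LINT x|lborel. ?k x)" .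
    have "ennreal (norm (LINT x|lborel. ?k x)) \<le> ennreal \<epsilon>"
      using integral_norm_bound_ennreal[OF j] t unfolding nn by (rule order_trans)
    then show "norm ((LINT x|lborel. k x) - (LINT x|lborel. ?I r x *\<^sub>R k x)) \<le> \<epsilon>"
      unfolding * using e by simp
  qed
  have fatou: "(\<integral>\<^sup>+x. ennreal (norm (h x)) * ?J r x \<partial>lborel) \<le> ennreal \<epsilon>"
    if "\<forall>\<^sub>F n in sequentially. (\<integral>\<^sup>+x. ennreal (norm (H n x)) * ?J r x \<partial>lborel) \<le> ennreal \<epsilon>" for r \<epsilon>
  proof -
    have "(\<lambda>n. ennreal (norm (H n x)) * ?J r x) \<longlonglongrightarrow> ennreal (norm (h x)) * ?J r x" for x
    proof (cases "r \<le> norm x")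
      case True
      then show ?thesis by (simp add: tendsto_ennrealI tendsto_norm lim)
    qed simp
    then have eq: "liminf (\<lambda>n. ennreal (norm (H n x)) * ?J r x) = ennreal (norm (h x)) * ?J r x" for x
      by (intro lim_imp_Liminf) auto
    have "(\<integral>\<^sup>+x. ennreal (norm (h x)) * ?J r x \<partial>lborel)
        = (\<integral>\<^sup>+x. liminf (\<lambda>n. ennreal (norm (H n x)) * ?J r x) \<partial>lborel)"
      unfolding eq ..
    also have "\<dots> \<le> liminf (\<lambda>n. \<integral>\<^sup>+x. ennreal (norm (H n x)) * ?J r x \<partial>lborel)"
      by (rule nn_integral_liminf) measurable
    also have "\<dots> \<le> ennreal \<epsilon>"
      by (rule Liminf_le[OF _ that]) simp
    finally show ?thesis .
  qed
  obtain r1 where "\<forall>\<^sub>F n in sequentially. (\<integral>\<^sup>+x. ennreal (norm (H n x)) * ?J r1 x \<partial>lborel) \<le> ennreal 1"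
    using tails[of 1] by auto
  from split_integrable(1)[OF _ inner(1) fatou[OF this]] show "integrable lborel h" by simp
  show "(\<lambda>n. LINT x|lborel. H n x) \<longlonglongrightarrow> (LINT x|lborel. h x)"
  proof (rule metric_LIMSEQ_I)
    fix \<epsilon>' :: real assume "0 < \<epsilon>'"
    define \<epsilon> where "\<epsilon> = \<epsilon>' / 4"
    have \<epsilon>: "0 < \<epsilon>" using \<open>0 < \<epsilon>'\<close> by (simp add: \<epsilon>_def)
    obtain r where r: "\<forall>\<^sub>F n in sequentially. (\<integral>\<^sup>+x. ennreal (norm (H n x)) * ?J r x \<partial>lborel) \<le> ennreal \<epsilon>"
      using tails[OF \<epsilon>] by auto
    have h: "norm ((LINT x|lborel. h x) - (LINT x|lborel. ?I r x *\<^sub>R h x)) \<le> \<epsilon>"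
      by (rule split_integrable(2)[OF _ inner(1) fatou[OF r] \<epsilon>]) measurable
    have "\<forall>\<^sub>F n in sequentially. dist (LINT x|lborel. ?I r x *\<^sub>R H n x) (LINT x|lborel. ?I r x *\<^sub>R h x) < \<epsilon>"
      using tendstoD[OF inner(3) \<epsilon>] .
    with r have "\<forall>\<^sub>F n in sequentially. dist (LINT x|lborel. H n x) (LINT x|lborel. h x) < \<epsilon>'"
    proof eventually_elim
      case (elim n)
      have "norm ((LINT x|lborel. H n x) - (LINT x|lborel. ?I r x *\<^sub>R H n x)) \<le> \<epsilon>"
        by (rule split_integrable(2)[OF _ inner(2) elim(1) \<epsilon>]) measurable
      then have "dist (LINT x|lborel. H n x) (LINT x|lborel. ?I r x *\<^sub>R H n x) \<le> \<epsilon>"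
        by (simp add: dist_norm)
      moreover have "dist (LINT x|lborel. h x) (LINT x|lborel. ?I r x *\<^sub>R h x) \<le> \<epsilon>"
        using h by (simp add: dist_norm)
      ultimately show ?case
        using elim(2) \<epsilon> dist_triangle[of "LINT x|lborel. H n x" "LINT x|lborel. h x" "LINT x|lborel. ?I r x *\<^sub>R H n x"]
          dist_triangle[of "LINT x|lborel. ?I r x *\<^sub>R H n x" "LINT x|lborel. h x" "LINT x|lborel. ?I r x *\<^sub>R h x"]
        by (simp add: \<epsilon>_def dist_commute)
    qed
    then show "\<exists>no. \<forall>n\<ge>no. dist (LINT x|lborel. H n x) (LINT x|lborel. h x) < \<epsilon>'"
      by (simp add: eventually_sequentially)
  qed
qed

lemma integrable_exp_abs:
  fixes k :: real assumes k: "0 < k"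
  shows "integrable lborel (\<lambda>u. exp (- (k * \<bar>u\<bar>)))"
proof -
  interpret prob_space "density lborel (exponential_density k)"
    by (rule prob_space_exponential_density[OF k])
  have e: "integrable lborel (exponential_density k)"
    using integrable_const[of "1::real"] exponential_density_nonneg[OF k]
    by (subst (asm) integrable_density) auto
  have "integrable lborel (\<lambda>u. (exponential_density k u + exponential_density k (0 + (-1) * u)) / k)"
    using lborel_integrable_real_affine[OF e, of "-1" 0]
    by (intro integrable_divide Bochner_Integration.integrable_add e) auto
  then show ?thesis
    by (rule Bochner_Integration.integrable_bound)
      (use k in \<open>auto simp: exponential_density_def abs_if mult.commute intro!: AE_I2\<close>)
qed

text \<open>
  The norm dominates the average of the absolute values of the coordinates, which reduces the claim to a
  product of one-dimensional integrals.
\<close>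

lemma integrable_exp_norm:
  fixes k :: real assumes k: "0 < k"
  shows "integrable lborel (\<lambda>x::'a::euclidean_space. exp (- (k * norm x)))"
proof -
  let ?d = "real DIM('a)"
  have "integrable lborel (\<lambda>x::'a. \<Prod>b\<in>Basis. exp (- (k / ?d * \<bar>x \<bullet> b\<bar>)))"
    using k by (intro lborel_integral_prod(1) integrable_exp_abs) auto
  then show ?thesis
  proof (rule Bochner_Integration.integrable_bound)
    show "AE x::'a in lborel. norm (exp (- (k * norm x))) \<le> norm (\<Prod>b\<in>Basis. exp (- (k / ?d * \<bar>x \<bullet> b\<bar>)))"
    proof (intro AE_I2)
      fix x :: 'a
      have "(\<Sum>b\<in>Basis. \<bar>x \<bullet> b\<bar>) \<le> (\<Sum>b\<in>(Basis::'a set). norm x)"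
        by (intro sum_mono) (simp add: Basis_le_norm)
      then have "k / ?d * (\<Sum>b\<in>Basis. \<bar>x \<bullet> b\<bar>) \<le> k / ?d * (?d * norm x)"
        using k by (intro mult_left_mono) auto
      then show "norm (exp (- (k * norm x))) \<le> norm (\<Prod>b\<in>Basis. exp (- (k / ?d * \<bar>x \<bullet> b\<bar>)))"
        by (simp add: exp_sum[symmetric] sum_negf sum_distrib_left)
    qed
  qed measurable
qed

section \<open>Random vectors with a real characteristic function\<close>

context prob_space
begin

context
  fixes Z :: "'a \<Rightarrow> 'b::euclidean_space" and \<phi> :: "'b \<Rightarrow> real"
  assumes Z[measurable]: "random_variable borel Z"
    and char: "\<And>x. (CLINT \<omega>|M. iexp (x \<bullet> Z \<omega>)) = complex_of_real (\<phi> x)"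
begin

lemma integrable_one_minus_cos: "integrable M (\<lambda>\<omega>. 1 - cos (x \<bullet> Z \<omega>))"
proof (rule integrable_const_bound[of _ 2])
  have "\<bar>1 - cos t\<bar> \<le> 2" for t :: real
    using cos_ge_minus_one[of t] cos_le_one[of t] by linarith
  then show "AE \<omega> in M. norm (1 - cos (x \<bullet> Z \<omega>)) \<le> 2" by simp
qed measurable

lemma expectation_one_minus_cos: "expectation (\<lambda>\<omega>. 1 - cos (x \<bullet> Z \<omega>)) = 1 - \<phi> x"
proof -
  have i: "integrable M (\<lambda>\<omega>. iexp (x \<bullet> Z \<omega>))"
    by (rule integrable_const_bound[of _ 1]) auto
  have "\<phi> x = Re (CLINT \<omega>|M. iexp (x \<bullet> Z \<omega>))" by (simp add: char)
  also have "\<dots> = expectation (\<lambda>\<omega>. Re (iexp (x \<bullet> Z \<omega>)))"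
    by (rule integral_Re[symmetric, OF i])
  finally have "\<phi> x = expectation (\<lambda>\<omega>. cos (x \<bullet> Z \<omega>))"
    by (simp add: exp_Euler cos_of_real sin_of_real)
  moreover have "integrable M (\<lambda>\<omega>. cos (x \<bullet> Z \<omega>))"
    by (rule integrable_const_bound[of _ 1]) auto
  ultimately show ?thesis
    by (simp add: Bochner_Integration.integral_diff prob_space)
qed

lemma real_char_le_one: "\<phi> x \<le> 1"
proof -
  have "0 \<le> expectation (\<lambda>\<omega>. 1 - cos (x \<bullet> Z \<omega>))" by (rule Bochner_Integration.integral_nonneg) auto
  then show ?thesis by (simp add: expectation_one_minus_cos)
qed

lemma continuous_on_real_char: "continuous_on UNIV \<phi>"
proof -
  have "(\<lambda>n. expectation (\<lambda>\<omega>. 1 - cos (u n \<bullet> Z \<omega>))) \<longlonglongrightarrow> expectation (\<lambda>\<omega>. 1 - cos (x \<bullet> Z \<omega>))"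
    if "u \<longlonglongrightarrow> x" for u :: "nat \<Rightarrow> 'b" and x
  proof (rule integral_dominated_convergence[where w="\<lambda>_. 2"])
    have "\<bar>1 - cos t\<bar> \<le> 2" for t :: real
      using cos_ge_minus_one[of t] cos_le_one[of t] by linarith
    then show "AE \<omega> in M. norm (1 - cos (u n \<bullet> Z \<omega>)) \<le> 2" for n by simp
    show "AE \<omega> in M. (\<lambda>n. 1 - cos (u n \<bullet> Z \<omega>)) \<longlonglongrightarrow> 1 - cos (x \<bullet> Z \<omega>)"
      by (intro AE_I2 tendsto_intros that)
  qed auto
  then have "(\<lambda>n. 1 - (1 - \<phi> (u n))) \<longlonglongrightarrow> 1 - (1 - \<phi> x)" if "u \<longlonglongrightarrow> x" for u x
    using tendsto_diff[OF tendsto_const] that unfolding expectation_one_minus_cos by blast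
  then show ?thesis
    by (simp add: continuous_on_eq_continuous_at continuous_at_sequentially o_def)
qed

text \<open>
  Since \<open>1 - cos (2 t) = 2 (sin t)\<^sup>2\<close> and \<open>|sin (a + b)| \<le> |sin a| + |sin b|\<close>, the square root of \<open>1 - cos\<close> is
  subadditive; the weights \<open>1 + \<kappa>\<close> and \<open>1 + 1/\<kappa>\<close> express this in a form that survives taking expectations
  and that remains sharp in \<open>x\<close> when \<open>y\<close> contributes little.
\<close>

lemma one_minus_real_char_add:
  assumes \<kappa>: "0 < \<kappa>"
  shows "1 - \<phi> (x + y) \<le> (1 + \<kappa>) * (1 - \<phi> x) + (1 + 1 / \<kappa>) * (1 - \<phi> y)"
proof -
  have *: "1 - cos (2 * (a + b)) \<le> (1 + \<kappa>) * (1 - cos (2 * a)) + (1 + 1 / \<kappa>) * (1 - cos (2 * b))" for a b :: real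
  proof -
    have s: "1 - cos (2 * t) = 2 * (sin t)\<^sup>2" for t :: real by (simp add: cos_double_sin)
    define p q where "p = \<bar>sin a\<bar>" and "q = \<bar>sin b\<bar>"
    have "\<bar>sin (a + b)\<bar> \<le> \<bar>sin a * cos b\<bar> + \<bar>cos a * sin b\<bar>"
      unfolding sin_add by (rule abs_triangle_ineq)
    also have "\<dots> \<le> p + q"
      by (auto simp: abs_mult p_def q_def intro!: add_mono mult_left_le mult_left_le_one_le)
    finally have "\<bar>sin (a + b)\<bar>\<^sup>2 \<le> (p + q)\<^sup>2" by (intro power_mono) auto
    also have "\<dots> \<le> (1 + \<kappa>) * p\<^sup>2 + (1 + 1 / \<kappa>) * q\<^sup>2"
    proof -
      have "0 \<le> (\<kappa> * p - q)\<^sup>2 / \<kappa>" using \<kappa> by simp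
      also have "\<dots> = \<kappa> * p\<^sup>2 + q\<^sup>2 / \<kappa> - 2 * p * q"
        using \<kappa> by (simp add: field_simps power2_eq_square)
      finally show ?thesis using \<kappa> by (simp add: field_simps power2_eq_square)
    qed
    finally show ?thesis unfolding s by (simp add: p_def q_def algebra_simps)
  qed
  have "1 - \<phi> (x + y) = expectation (\<lambda>\<omega>. 1 - cos ((x + y) \<bullet> Z \<omega>))"
    by (simp add: expectation_one_minus_cos)
  also have "\<dots> \<le> expectation (\<lambda>\<omega>. (1 + \<kappa>) * (1 - cos (x \<bullet> Z \<omega>)) + (1 + 1 / \<kappa>) * (1 - cos (y \<bullet> Z \<omega>)))"
  proof (intro integral_mono integrable_one_minus_cos Bochner_Integration.integrable_add integrable_mult_right)
    fix \<omega> show "1 - cos ((x + y) \<bullet> Z \<omega>) \<le> (1 + \<kappa>) * (1 - cos (x \<bullet> Z \<omega>)) + (1 + 1 / \<kappa>) * (1 - cos (y \<bullet> Z \<omega>))"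
      using *[of "x \<bullet> Z \<omega> / 2" "y \<bullet> Z \<omega> / 2"] by (simp add: inner_add_left)
  qed
  also have "\<dots> = (1 + \<kappa>) * (1 - \<phi> x) + (1 + 1 / \<kappa>) * (1 - \<phi> y)"
    by (subst Bochner_Integration.integral_add)
      (intro integrable_one_minus_cos integrable_mult_right, intro integrable_one_minus_cos integrable_mult_right,
        simp only: integral_mult_right_zero expectation_one_minus_cos)
  finally show ?thesis .
qed

text \<open>
  The average of \<open>1 - cos (s u)\<close> over \<open>0 \<le> s \<le> S\<close> is \<open>1 - sin (S u) / (S u)\<close>, which is at least \<open>1/2\<close> as soon
  as \<open>|u| \<ge> 2/S\<close>. So the tail of a random variable is controlled by its characteristic function
  near the origin.
\<close>

lemma prob_inner_ge_le:
  assumes S: "0 < S" and m: "\<And>s. 0 \<le> s \<Longrightarrow> s \<le> S \<Longrightarrow> 1 - \<phi> (s *\<^sub>R b) \<le> m"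
  shows "prob {\<omega> \<in> space M. 2 / S \<le> \<bar>b \<bullet> Z \<omega>\<bar>} \<le> 2 * m"
proof -
  have m0: "0 \<le> m" using m[of 0] real_char_le_one[of 0] S by simp
  interpret pair_sigma_finite "lborel :: real measure" M ..
  let ?A = "{\<omega> \<in> space M. 2 / S \<le> \<bar>b \<bullet> Z \<omega>\<bar>}"
  have [measurable]: "?A \<in> sets M" by measurable
  let ?g = "\<lambda>s \<omega>. ennreal (1 - cos (s * (b \<bullet> Z \<omega>))) * indicator {0..S} s"
  have avg: "ennreal (S / 2) * indicator ?A \<omega> \<le> (\<integral>\<^sup>+s. ?g s \<omega> \<partial>lborel)" for \<omega>
  proof (cases "\<omega> \<in> ?A")
    case True
    define u where "u = b \<bullet> Z \<omega>"
    have u: "2 / S \<le> \<bar>u\<bar>" using True by (simp add: u_def)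
    then have u0: "0 < \<bar>u\<bar>" using S by (smt (verit) divide_pos_pos)
    have "(\<integral>\<^sup>+s. ennreal (1 - cos (s * u)) * indicator {0..S} s \<partial>lborel) = ennreal ((S - sin (S * u) / u) - (0 - sin (0 * u) / u))"
      using S u0 by (intro nn_integral_FTC_Icc) (auto intro!: derivative_eq_intros)
    moreover have "S / 2 \<le> S - sin (S * u) / u"
    proof -
      have "\<bar>sin (S * u) / u\<bar> \<le> 1 / \<bar>u\<bar>" using u0 by (simp add: divide_right_mono)
      also have "\<dots> \<le> S / 2" using u S u0 by (simp add: field_simps)
      finally show ?thesis by linarith
    qed
    ultimately show ?thesis using True by (simp add: u_def ennreal_leI)
  qed simp
  have "ennreal (S / 2) * emeasure M ?A = (\<integral>\<^sup>+\<omega>. ennreal (S / 2) * indicator ?A \<omega> \<partial>M)"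
    by (rule nn_integral_cmult_indicator[symmetric]) measurable
  also have "\<dots> \<le> (\<integral>\<^sup>+\<omega>. \<integral>\<^sup>+s. ?g s \<omega> \<partial>lborel \<partial>M)"
    by (intro nn_integral_mono avg)
  also have "\<dots> = (\<integral>\<^sup>+s. \<integral>\<^sup>+\<omega>. ?g s \<omega> \<partial>M \<partial>lborel)"
    by (rule Fubini') measurable
  also have "\<dots> \<le> (\<integral>\<^sup>+s. ennreal m * indicator {0..S} s \<partial>lborel)"
  proof (rule nn_integral_mono)
    fix s :: real
    show "(\<integral>\<^sup>+\<omega>. ?g s \<omega> \<partial>M) \<le> ennreal m * indicator {0..S} s"
    proof (cases "s \<in> {0..S}")
      case True
      have "(\<integral>\<^sup>+\<omega>. ennreal (1 - cos ((s *\<^sub>R b) \<bullet> Z \<omega>)) \<partial>M) = ennreal (1 - \<phi> (s *\<^sub>R b))"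
        by (subst nn_integral_eq_integral[OF integrable_one_minus_cos]) (simp_all add: expectation_one_minus_cos del: inner_scaleR_left)
      then show ?thesis using True m by (simp add: ennreal_leI)
    qed simp
  qed
  also have "\<dots> = ennreal (m * S)"
    using S m0 by (simp add: nn_integral_cmult_indicator ennreal_mult)
  finally have "ennreal (S / 2 * prob ?A) \<le> ennreal (m * S)"
    using S by (simp only: emeasure_eq_measure ennreal_mult[OF _ measure_nonneg])
  then have "S / 2 * prob ?A \<le> m * S"
    using m0 S by (simp add: ennreal_le_iff)
  then show ?thesis using S by (simp add: field_simps)
qed

text \<open>
  If the norm is at least \<open>r\<close>, some coordinate is at least \<open>r\<close> divided by the dimension.
\<close>

lemma prob_norm_ge_le:
  fixes m :: real
  assumes r: "0 < r" and m: "\<And>x. norm x \<le> 2 * DIM('b) / r \<Longrightarrow> 1 - \<phi> x \<le> m"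
  shows "prob {\<omega> \<in> space M. r \<le> norm (Z \<omega>)} \<le> 2 * DIM('b) * m"
proof -
  let ?d = "real DIM('b)"
  let ?S = "2 * ?d / r"
  let ?A = "\<lambda>b. {\<omega> \<in> space M. 2 / ?S \<le> \<bar>b \<bullet> Z \<omega>\<bar>}"
  have S: "0 < ?S" using r by simp
  have S2: "2 / ?S = r / ?d" using r by (simp add: field_simps)
  have "{\<omega> \<in> space M. r \<le> norm (Z \<omega>)} \<subseteq> (\<Union>b\<in>Basis. ?A b)"
  proof
    fix \<omega> assume \<omega>: "\<omega> \<in> {\<omega> \<in> space M. r \<le> norm (Z \<omega>)}"
    show "\<omega> \<in> (\<Union>b\<in>Basis. ?A b)"
    proof (rule ccontr)
      assume "\<not> ?thesis"
      then have "\<bar>Z \<omega> \<bullet> b\<bar> < r / ?d" if "b \<in> Basis" for b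
        using that \<omega> S2 by (force simp: inner_commute)
      then have "(\<Sum>b\<in>Basis. \<bar>Z \<omega> \<bullet> b\<bar>) < (\<Sum>b\<in>(Basis::'b set). r / ?d)"
        by (intro sum_strict_mono) auto
      then show False using norm_le_l1[of "Z \<omega>"] \<omega> by simp
    qed
  qed
  then have "prob {\<omega> \<in> space M. r \<le> norm (Z \<omega>)} \<le> prob (\<Union>b\<in>Basis. ?A b)"
  proof (rule finite_measure_mono)
    have [measurable]: "?A b \<in> sets M" for b by measurable
    show "(\<Union>b\<in>Basis. ?A b) \<in> sets M" by (intro sets.finite_UN) auto
  qed
  also have "\<dots> \<le> (\<Sum>b\<in>Basis. prob (?A b))"
    by (intro finite_measure_subadditive_finite) auto
  also have "\<dots> \<le> (\<Sum>b\<in>(Basis::'b set). 2 * m)"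
    using S m by (intro sum_mono prob_inner_ge_le) auto
  finally show ?thesis by simp
qed

end

end

text \<open>
  The formula for the exponent gives \<open>\<psi> (- x) = cnj (\<psi> x)\<close> when the drift vanishes, and invariance of the
  jump measure under reflection gives \<open>\<psi> (- x) = \<psi> x\<close>.
\<close>

lemma levy_exponent_symmetric:
  fixes \<psi> :: "real ^ 'c \<Rightarrow> complex"
  assumes exponent: "levy_exponent P X A \<gamma> \<nu> \<psi>" and sym: "symmetric_triplet \<gamma> \<nu>"
  shows "\<psi> (- x) = \<psi> x" and "\<psi> x = complex_of_real (Re (\<psi> x))"
proof -
  have \<gamma>: "\<gamma> = 0" and \<nu>: "distr \<nu> borel uminus = \<nu>" using sym by (auto simp: symmetric_triplet_def)
  have [measurable_cong]: "sets \<nu> = sets borel" and lk: "\<And>x. \<psi> x = levy_khintchine A \<gamma> \<nu> x"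
    using exponent by (auto simp: levy_exponent_def levy_triplet_def levy_measure_def)
  have [measurable]: "cball (0::real ^ 'c) 1 \<in> sets borel" by simp
  let ?k = "\<lambda>x y. iexp (x \<bullet> y) - 1 - \<i> * complex_of_real (x \<bullet> y) * indicator (cball 0 1) y"
  have "(CLINT y|\<nu>. ?k (- x) y) = (CLINT y|\<nu>. ?k x (- y))" for x
    by (simp add: indicator_def)
  also have "(CLINT y|\<nu>. ?k x (- y)) = (CLINT y|distr \<nu> borel uminus. ?k x y)" for x
    by (subst integral_distr) auto
  finally have even: "(CLINT y|\<nu>. ?k (- x) y) = (CLINT y|\<nu>. ?k x y)" for x
    unfolding \<nu> .
  have mv: "A *v (- x) = - (A *v x)" for x
    by (metis matrix_vector_mult_scaleR scaleR_minus1_left)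
  show *: "\<psi> (- x) = \<psi> x" for x
    unfolding lk levy_khintchine_def even \<gamma> by (simp add: mv)
  have "(CLINT y|\<nu>. ?k (- x) y) = (CLINT y|\<nu>. cnj (?k x y))"
    by (intro Bochner_Integration.integral_cong) (auto simp: exp_cnj indicator_def)
  then have "(CLINT y|\<nu>. ?k (- x) y) = cnj (CLINT y|\<nu>. ?k x y)"
    by (simp only: Bochner_Integration.integral_cnj)
  then have "\<psi> (- x) = cnj (\<psi> x)"
    unfolding lk levy_khintchine_def \<gamma> by (simp add: mv)
  then show "\<psi> x = complex_of_real (Re (\<psi> x))"
    unfolding * by (simp add: complex_eq_iff)
qed

section \<open>Regular variation and generalized inverses\<close>

text \<open>
  A single doubling step multiplies \<open>\<phi>\<close> by at least \<open>2 powr a\<close> once \<open>s\<close> is large. Iterating it handles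
  \<open>l = 2 ^ n\<close>, and the monotonicity of \<open>U\<close>, which is comparable to \<open>\<phi>\<close>, fills the gaps between powers of two.
  Read with \<open>s\<close> and \<open>l * s\<close> exchanged, the conclusion is also an upper bound for \<open>U\<close> at smaller arguments.
\<close>

lemma potter_lower_bound:
  fixes U \<phi> :: "real \<Rightarrow> real"
  assumes U_mono: "\<And>u v. 0 \<le> u \<Longrightarrow> u \<le> v \<Longrightarrow> U u \<le> U v" and U_nonneg: "\<And>u. 0 \<le> u \<Longrightarrow> 0 \<le> U u"
    and cmp: "0 < c" "\<And>s. 1 \<le> s \<Longrightarrow> c * U s \<le> \<phi> s" "\<And>s. 1 \<le> s \<Longrightarrow> \<phi> s \<le> U s"
    and lim: "((\<lambda>s. \<phi> (2 * s) / \<phi> s) \<longlongrightarrow> 2 powr \<alpha>) at_top"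
    and a: "0 < a" "a < \<alpha>"
  obtains k where "0 < k" "\<And>s l. 1 \<le> s \<Longrightarrow> 1 \<le> l \<Longrightarrow> k * l powr a * U s \<le> U (l * s)"
proof -
  have "\<forall>\<^sub>F s in at_top. 2 powr a < \<phi> (2 * s) / \<phi> s"
    using order_tendstoD(1)[OF lim] a by simp
  then obtain s1 where s1: "\<And>s. s1 \<le> s \<Longrightarrow> 2 powr a < \<phi> (2 * s) / \<phi> s"
    by (auto simp: eventually_at_top_linorder)
  define s0 where "s0 = max 1 s1"
  have s0: "1 \<le> s0" by (simp add: s0_def)
  have nn: "0 \<le> \<phi> s" if "1 \<le> s" for s
    using cmp(2)[OF that] mult_nonneg_nonneg[of c "U s"] cmp(1) U_nonneg[of s] that by linarith
  have dbl: "2 powr a * \<phi> s \<le> \<phi> (2 * s)" if "s0 \<le> s" for s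
  proof -
    have *: "2 powr a < \<phi> (2 * s) / \<phi> s" using that by (intro s1) (simp add: s0_def)
    then have "\<phi> s \<noteq> 0" using powr_ge_zero[of 2 a] by (metis div_by_0 not_le)
    then have "0 < \<phi> s" using nn[of s] s0 that by auto
    then show ?thesis using * by (simp add: field_simps)
  qed
  have iter: "(2 ^ n) powr a * \<phi> s \<le> \<phi> (2 ^ n * s)" if "s0 \<le> s" for n s
  proof (induction n)
    case (Suc n)
    have "1 * s0 \<le> 2 ^ n * s" using that s0 by (intro mult_mono) auto
    then have "2 powr a * \<phi> (2 ^ n * s) \<le> \<phi> (2 * (2 ^ n * s))" by (intro dbl) simp
    moreover have "2 powr a * ((2 ^ n) powr a * \<phi> s) \<le> 2 powr a * \<phi> (2 ^ n * s)"
      using Suc by (intro mult_left_mono) auto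
    ultimately have "2 powr a * ((2 ^ n) powr a * \<phi> s) \<le> \<phi> (2 * (2 ^ n * s))" by (rule order_trans[rotated])
    then show ?case by (simp add: powr_mult mult.assoc)
  qed simp
  define k0 where "k0 = c * (1/2) powr a"
  have k0: "0 < k0" using cmp by (simp add: k0_def)
  have far: "k0 * l powr a * U s \<le> U (l * s)" if s: "s0 \<le> s" and l: "1 \<le> l" for s l
  proof -
    define n where "n = nat \<lfloor>log 2 l\<rfloor>"
    have n: "2 ^ n \<le> l" "l < 2 ^ Suc n"
      using l floor_log_eq_powr_iff[of l 2 "\<lfloor>log 2 l\<rfloor>"]
      by (auto simp: n_def powr_realpow[symmetric] powr_add)
    have sp: "1 \<le> s" using s s0 by linarith
    have "k0 * l powr a * U s = (l / 2) powr a * (c * U s)"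
      using l by (simp add: k0_def powr_divide)
    also have "\<dots> \<le> (2 ^ n) powr a * (c * U s)"
      using n l a cmp(1) U_nonneg[of s] sp by (intro mult_right_mono powr_mono2) auto
    also have "\<dots> \<le> (2 ^ n) powr a * \<phi> s"
      using cmp(2)[OF sp] by (intro mult_left_mono) auto
    also have "\<dots> \<le> \<phi> (2 ^ n * s)" by (rule iter[OF s])
    also have "\<dots> \<le> U (2 ^ n * s)"
      using sp mult_mono[of 1 "2^n" 1 s] by (intro cmp) auto
    also have "\<dots> \<le> U (l * s)"
      using n sp by (intro U_mono mult_right_mono) auto
    finally show ?thesis .
  qed
  \<comment> \<open>Below the threshold \<open>s0\<close> of the doubling estimate only a bounded factor is lost; it
      is absorbed into the constant so that the bound holds from \<open>1\<close> on.\<close>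
  define k where "k = min k0 1 * (1 / s0) powr a"
  have k: "0 < k" using k0 s0 by (simp add: k_def)
  have s0a: "(1 / s0) powr a \<le> 1" using s0 a by (intro powr_le1) auto
  show ?thesis
  proof (rule that[OF k])
    fix s l :: real assume s: "1 \<le> s" and l: "1 \<le> l"
    have Us: "0 \<le> U s" using s by (intro U_nonneg) auto
    consider "s0 \<le> s" | "s < s0" "s0 \<le> l" | "s < s0" "l < s0" by linarith
    then show "k * l powr a * U s \<le> U (l * s)"
    proof cases
      case 1
      have "k \<le> k0" unfolding k_def using k0 s0a mult_mono[of "min k0 1" k0 "(1/s0) powr a" 1] by simp
      then have "k * l powr a * U s \<le> k0 * l powr a * U s"
        using Us by (intro mult_right_mono) auto
      with far[OF 1 l] show ?thesis by linarith
    next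
      case 2
      have "k * l powr a * U s = min k0 1 * (l / s0) powr a * U s"
        using l s0 by (simp add: k_def powr_divide)
      also have "\<dots> \<le> k0 * (l / s0) powr a * U s0"
        using 2 s s0 Us k0 U_mono[of s s0] by (intro mult_mono) auto
      also have "\<dots> \<le> U (l / s0 * s0)"
        using 2 s0 by (intro far) auto
      also have "\<dots> \<le> U (l * s)"
        using s l s0 mult_left_mono[of 1 s l] by (intro U_mono) auto
      finally show ?thesis .
    next
      case 3
      have "k * l powr a = min k0 1 * (l / s0) powr a"
        using l s0 by (simp add: k_def powr_divide)
      also have "\<dots> \<le> 1 * 1"
        using 3 l s0 k0 a by (intro mult_mono powr_le1) auto
      finally have "k * l powr a * U s \<le> 1 * U s" using Us by (intro mult_right_mono) auto
      also have "\<dots> \<le> U (l * s)" using s l mult_right_mono[of 1 l s] U_mono[of s "l * s"] by auto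
      finally show ?thesis .
    qed
  qed
qed

text \<open>
  Uniformly for \<open>x\<close> between \<open>s\<close> and \<open>(1 + \<eta>) s\<close>, subadditivity bounds \<open>\<phi> x\<close> by \<open>(1 + \<kappa>) \<phi> s\<close> plus a multiple of
  \<open>U (\<eta> s)\<close>, and by the growth bound the latter is a small multiple of \<open>\<phi> s\<close>. As \<open>\<phi>\<close> and \<open>V\<close> are asymptotically
  proportional, \<open>V\<close> inherits the estimate. This is the local uniformity of regular variation that is needed for
  the generalized inverse.
\<close>

lemma almost_increasing_of_subadditive:
  fixes U \<phi> V :: "real \<Rightarrow> real"
  assumes U_mono: "\<And>u v. 0 \<le> u \<Longrightarrow> u \<le> v \<Longrightarrow> U u \<le> U v"
    and cmp: "0 < c" "\<And>s. 1 \<le> s \<Longrightarrow> c * U s \<le> \<phi> s"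
    and nonneg: "\<And>s. 0 \<le> s \<Longrightarrow> 0 \<le> \<phi> s"
    and sub: "\<And>\<kappa> s r. 0 < \<kappa> \<Longrightarrow> 0 \<le> s \<Longrightarrow> 0 \<le> r \<Longrightarrow> \<phi> (s + r) \<le> (1 + \<kappa>) * \<phi> s + (1 + 1 / \<kappa>) * U r"
    and potter: "0 < k" "\<And>s l. 1 \<le> s \<Longrightarrow> 1 \<le> l \<Longrightarrow> k * l powr a * U s \<le> U (l * s)" and a: "0 < a"
    and V_pos: "\<And>s. 0 \<le> s \<Longrightarrow> 0 < V s"
    and lim: "((\<lambda>s. \<phi> s / V s) \<longlongrightarrow> v) at_top" "0 < v"
    and \<epsilon>: "0 < \<epsilon>"
  obtains \<eta> where "0 < \<eta>" "\<forall>\<^sub>F s in at_top. \<forall>x\<in>{s..(1 + \<eta>) * s}. V x \<le> (1 + \<epsilon>) * V s"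
proof -
  \<comment> \<open>\<open>\<eta>\<close> is chosen so that \<open>W * \<eta> powr a \<le> \<kappa>\<close>, and \<open>\<delta>\<close> solves
      \<open>(1 + \<epsilon>/2) (1 + \<delta>) = (1 + \<epsilon>) (1 - \<delta>)\<close>.\<close>
  define \<kappa> where "\<kappa> = \<epsilon> / 4"
  define W where "W = (1 + 1 / \<kappa>) / (k * c)"
  define \<eta> where "\<eta> = min 1 ((\<kappa> / W) powr (1 / a))"
  define \<delta> where "\<delta> = \<epsilon> / (4 + 3 * \<epsilon>)"
  have \<kappa>: "0 < \<kappa>" using \<epsilon> by (simp add: \<kappa>_def)
  have W: "0 < W" using \<kappa> potter cmp by (auto simp: W_def intro!: divide_pos_pos add_pos_pos)
  have \<eta>: "0 < \<eta>" "\<eta> \<le> 1" using \<kappa> W by (auto simp: \<eta>_def)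
  have "\<eta> powr a \<le> ((\<kappa> / W) powr (1 / a)) powr a"
    using \<eta> a by (intro powr_mono2) (auto simp: \<eta>_def)
  also have "\<dots> = \<kappa> / W" using \<kappa> W a by (simp add: powr_powr)
  finally have W\<eta>: "W * \<eta> powr a \<le> \<kappa>" using W by (simp add: field_simps)
  have \<delta>: "0 < \<delta>" "\<delta> < 1" "(1 + \<epsilon> / 2) * (1 + \<delta>) = (1 + \<epsilon>) * (1 - \<delta>)"
    using \<epsilon> by (auto simp: \<delta>_def field_simps)
  have growth: "\<phi> x \<le> (1 + \<epsilon> / 2) * \<phi> s" if s: "1 / \<eta> \<le> s" and x: "x \<in> {s..(1 + \<eta>) * s}" for s x
  proof -
    have "1 \<le> 1 / \<eta>" using \<eta> by simp
    with s have s1: "1 \<le> s" by linarith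
    have s2: "1 \<le> \<eta> * s" using s \<eta> by (simp add: field_simps)
    have "k * (1 / \<eta>) powr a * U (\<eta> * s) \<le> U (1 / \<eta> * (\<eta> * s))"
      using s2 \<eta> by (intro potter) auto
    then have "U (\<eta> * s) \<le> \<eta> powr a / k * U s"
      using \<eta> potter(1) by (simp add: powr_divide field_simps)
    also have "\<dots> \<le> \<eta> powr a / k * (\<phi> s / c)"
      using cmp(2)[OF s1] cmp(1) potter(1) by (intro mult_left_mono) (auto simp: field_simps)
    finally have U: "U (\<eta> * s) \<le> \<eta> powr a / k * (\<phi> s / c)" .
    have "\<phi> x = \<phi> (s + (x - s))" by simp
    also have "\<dots> \<le> (1 + \<kappa>) * \<phi> s + (1 + 1 / \<kappa>) * U (x - s)"
      using x s1 \<kappa> by (intro sub) auto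
    also have "\<dots> \<le> (1 + \<kappa>) * \<phi> s + (1 + 1 / \<kappa>) * (\<eta> powr a / k * (\<phi> s / c))"
      using x \<kappa> U U_mono[of "x - s" "\<eta> * s"]
      by (intro add_left_mono mult_left_mono) (auto simp: algebra_simps)
    also have "\<dots> = (1 + \<kappa> + W * \<eta> powr a) * \<phi> s"
      using potter(1) cmp(1) by (simp add: W_def field_simps)
    also have "\<dots> \<le> (1 + \<epsilon> / 2) * \<phi> s"
      using W\<eta> s1 nonneg[of s] by (intro mult_right_mono) (auto simp: \<kappa>_def)
    finally show ?thesis .
  qed
  have "\<forall>\<^sub>F s in at_top. v * (1 - \<delta>) < \<phi> s / V s" "\<forall>\<^sub>F s in at_top. \<phi> s / V s < v * (1 + \<delta>)"
    using order_tendstoD[OF lim(1)] lim(2) \<delta> by auto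
  then have "\<forall>\<^sub>F s in at_top. v * (1 - \<delta>) < \<phi> s / V s \<and> \<phi> s / V s < v * (1 + \<delta>)"
    by (rule eventually_conj)
  then obtain s1 where s1: "\<And>s. s1 \<le> s \<Longrightarrow> v * (1 - \<delta>) < \<phi> s / V s \<and> \<phi> s / V s < v * (1 + \<delta>)"
    by (auto simp: eventually_at_top_linorder)
  have V: "v * (1 - \<delta>) * V s \<le> \<phi> s" "\<phi> s \<le> v * (1 + \<delta>) * V s" if "s1 \<le> s" "0 \<le> s" for s
    using s1[OF that(1)] V_pos[OF that(2)] by (auto simp: field_simps)
  show ?thesis
  proof (rule that[OF \<eta>(1)], rule eventually_at_top_linorderI[of "max (max s1 0) (1 / \<eta>)"], intro ballI)
    fix s x assume s: "max (max s1 0) (1 / \<eta>) \<le> s" and x: "x \<in> {s..(1 + \<eta>) * s}"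
    have "v * (1 - \<delta>) * V x \<le> \<phi> x" using s x by (intro V) auto
    also have "\<dots> \<le> (1 + \<epsilon> / 2) * \<phi> s" using s x by (intro growth) auto
    also have "\<dots> \<le> (1 + \<epsilon> / 2) * (v * (1 + \<delta>) * V s)"
      using \<epsilon> s by (intro mult_left_mono V) auto
    also have "\<dots> = v * V s * ((1 + \<epsilon> / 2) * (1 + \<delta>))" by (simp add: algebra_simps)
    also have "\<dots> = v * (1 - \<delta>) * ((1 + \<epsilon>) * V s)" by (simp only: \<delta>(3)) (simp add: algebra_simps)
    finally show "V x \<le> (1 + \<epsilon>) * V s" using lim(2) \<delta> by (simp add: mult_le_cancel_left)
  qed
qed

text \<open>
  Local boundedness of \<open>V\<close> keeps the points where \<open>V\<close> exceeds a large level away from every bounded interval.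
\<close>

lemma generalized_inverse_tendsto_at_top:
  assumes V: "regularly_varying \<alpha> V" and inf: "filterlim V at_top at_top"
  shows "filterlim (generalized_inverse V) at_top at_top"
  unfolding filterlim_at_top
proof
  fix Z :: real
  have "compact {0..max 0 Z}" "{0..max 0 Z} \<subseteq> {0::real..}" by auto
  then have "bounded (V ` {0..max 0 Z})" using V unfolding regularly_varying_def by blast
  then obtain B where B: "\<And>x. x \<in> {0..max 0 Z} \<Longrightarrow> norm (V x) \<le> B"
    unfolding bounded_iff by blast
  show "\<forall>\<^sub>F u in at_top. Z \<le> generalized_inverse V u"
  proof (rule eventually_at_top_linorderI[of "B + 1"])
    fix u assume u: "B + 1 \<le> u"
    have "\<forall>\<^sub>F x in at_top. 0 \<le> x \<and> u \<le> V x"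
      using inf eventually_ge_at_top[of 0] by (auto simp: filterlim_at_top intro: eventually_conj)
    then have "{x. 0 \<le> x \<and> u \<le> V x} \<noteq> {}"
      by (auto simp: eventually_at_top_linorder)
    moreover have "Z \<le> x" if "x \<in> {x. 0 \<le> x \<and> u \<le> V x}" for x
      using that B[of x] u by (cases "x \<le> max 0 Z") auto
    ultimately show "Z \<le> generalized_inverse V u"
      unfolding generalized_inverse_def by (intro cInf_greatest)
  qed
qed

text \<open>
  Left of \<open>V\<^sup>-(u)\<close> the values of \<open>V\<close> are below \<open>u\<close>, so regular variation at \<open>l V\<^sup>-(u)\<close> with \<open>l\<close> slightly below \<open>1\<close>
  bounds \<open>V (V\<^sup>-(u)) / u\<close> from above. Arbitrarily close to the right of \<open>V\<^sup>-(u)\<close>, or at it, \<open>V\<close> is at least \<open>u\<close>; since \<open>V\<close>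
  is not monotone, a bound at the point \<open>V\<^sup>-(u)\<close> itself needs the hypothesis that \<open>V\<close> grows little over
  short multiplicative intervals.
\<close>

lemma regularly_varying_generalized_inverse:
  assumes V: "regularly_varying \<alpha> V" and inf: "filterlim V at_top at_top"
    and inc: "\<And>\<epsilon>. 0 < \<epsilon> \<Longrightarrow>
      \<exists>\<eta>>0. \<forall>\<^sub>F s in at_top. \<forall>x\<in>{s..(1 + \<eta>) * s}. V x \<le> (1 + \<epsilon>) * V s"
  shows "((\<lambda>u. V (generalized_inverse V u) / u) \<longlongrightarrow> 1) at_top"
proof -
  let ?h = "generalized_inverse V"
  have h: "filterlim ?h at_top at_top" by (rule generalized_inverse_tendsto_at_top[OF V inf])
  have hpos: "\<forall>\<^sub>F u in at_top. 0 < ?h u" using h by (simp add: filterlim_at_top_dense)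
  have Vpos: "\<And>s. 0 \<le> s \<Longrightarrow> 0 < V s" and rv: "\<And>l. 0 < l \<Longrightarrow> ((\<lambda>s. V (l * s) / V s) \<longlongrightarrow> l powr \<alpha>) at_top"
    using V by (auto simp: regularly_varying_def)
  have bdd: "bdd_below {x. 0 \<le> x \<and> u \<le> V x}" for u by (intro bdd_belowI[of _ 0]) auto
  show ?thesis
  proof (rule order_tendstoI)
    fix y :: real assume "y < 1"
    define \<epsilon> where "\<epsilon> = (if y \<le> 0 then 1 else 1 / y - 1) / 2"
    have \<epsilon>: "0 < \<epsilon>" using \<open>y < 1\<close> by (auto simp: \<epsilon>_def field_simps)
    have y\<epsilon>: "y * (1 + \<epsilon>) < 1"
    proof (cases "y \<le> 0")
      case True then show ?thesis using \<epsilon> mult_nonpos_nonneg[of y "1 + \<epsilon>"] by linarith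
    next
      case False then show ?thesis using \<open>y < 1\<close> by (simp add: \<epsilon>_def field_simps)
    qed
    obtain \<eta> where \<eta>: "0 < \<eta>" "\<forall>\<^sub>F s in at_top. \<forall>x\<in>{s..(1 + \<eta>) * s}. V x \<le> (1 + \<epsilon>) * V s"
      using inc[OF \<epsilon>] by blast
    have "\<forall>\<^sub>F u in at_top. \<forall>x\<in>{?h u..(1 + \<eta>) * ?h u}. V x \<le> (1 + \<epsilon>) * V (?h u)"
      using filterlim_compose[OF _ h] \<eta>(2) h by (auto simp: filterlim_iff)
    then show "\<forall>\<^sub>F u in at_top. y < V (?h u) / u"
      using hpos eventually_gt_at_top[of 0]
    proof eventually_elim
      case (elim u)
      have "\<forall>\<^sub>F x in at_top. 0 \<le> x \<and> u \<le> V x"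
        using inf eventually_ge_at_top[of 0] by (auto simp: filterlim_at_top intro: eventually_conj)
      then have ne: "{x. 0 \<le> x \<and> u \<le> V x} \<noteq> {}"
        by (auto simp: eventually_at_top_linorder)
      have "?h u < (1 + \<eta>) * ?h u" using elim \<eta> by (simp add: algebra_simps)
      then obtain x where x: "0 \<le> x" "u \<le> V x" "x < (1 + \<eta>) * ?h u"
        unfolding generalized_inverse_def using cInf_less_iff[OF ne bdd] by auto
      have "?h u \<le> x" unfolding generalized_inverse_def using x by (intro cInf_lower bdd) auto
      then have "V x \<le> (1 + \<epsilon>) * V (?h u)" using x elim by auto
      then have "u \<le> (1 + \<epsilon>) * V (?h u)" using x by linarith
      then have "1 / (1 + \<epsilon>) \<le> V (?h u) / u" using elim \<epsilon> by (simp add: field_simps)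
      moreover have "y < 1 / (1 + \<epsilon>)" using y\<epsilon> \<epsilon> by (simp add: field_simps)
      ultimately show ?case by linarith
    qed
  next
    fix y :: real assume y: "1 < y"
    have "((\<lambda>l::real. 1 / l powr \<alpha>) \<longlongrightarrow> 1 / 1 powr \<alpha>) (at_left 1)"
      by (intro tendsto_intros) auto
    then have "\<forall>\<^sub>F l in at_left 1. 1 / l powr \<alpha> < y"
      using y by (intro order_tendstoD) auto
    moreover have "\<forall>\<^sub>F l in at_left 1. l \<in> {0<..<1::real}"
      by (rule eventually_at_left_real) simp
    ultimately have "\<forall>\<^sub>F l in at_left 1. 1 / l powr \<alpha> < y \<and> l \<in> {0<..<1::real}"
      by (rule eventually_conj)
    then obtain l where l: "1 / l powr \<alpha> < y" "0 < l" "l < 1"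
      using eventually_happens[of _ "at_left (1::real)"] by auto
    have "((\<lambda>u. 1 / (V (l * ?h u) / V (?h u))) \<longlongrightarrow> 1 / l powr \<alpha>) at_top"
      using l by (intro tendsto_intros filterlim_compose[OF rv h]) auto
    then have "\<forall>\<^sub>F u in at_top. 1 / (V (l * ?h u) / V (?h u)) < y"
      using l by (intro order_tendstoD) auto
    then show "\<forall>\<^sub>F u in at_top. V (?h u) / u < y"
      using hpos eventually_gt_at_top[of 0]
    proof eventually_elim
      case (elim u)
      have lt: "l * ?h u < ?h u" using l elim by simp
      have "V (l * ?h u) < u"
      proof (rule ccontr)
        assume "\<not> ?thesis"
        then have "?h u \<le> l * ?h u"
          unfolding generalized_inverse_def using l elim
          by (intro cInf_lower bdd) (auto simp: generalized_inverse_def)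
        then show False using lt by simp
      qed
      moreover have "0 < V (l * ?h u)" "0 < V (?h u)" using l elim by (auto intro!: Vpos)
      ultimately have "V (?h u) / u < V (?h u) / V (l * ?h u)"
        by (intro divide_strict_left_mono mult_pos_pos) auto
      also have "\<dots> < y" using elim by simp
      finally show ?case .
    qed
  qed
qed

section \<open>Exponents of symmetric processes\<close>

text \<open>
  From the process only the one-dimensional marginal laws enter, and these only through their characteristic
  functions. That the exponent is real encodes the symmetry.
\<close>

locale symmetric_exponent = prob_space P for P :: "'w measure" +
  fixes X :: "real \<Rightarrow> 'w \<Rightarrow> 'b::euclidean_space" and f :: "'b \<Rightarrow> real"
  assumes X_measurable: "\<And>t. 0 \<le> t \<Longrightarrow> random_variable borel (X t)"
    and char_X: "\<And>t x. 0 \<le> t \<Longrightarrow> (CLINT \<omega>|P. iexp (x \<bullet> X t \<omega>)) = complex_of_real (exp (- (t * f x)))"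
begin

lemma one_minus_char_tendsto: "((\<lambda>t. (1 - exp (- (t * y))) / t) \<longlongrightarrow> y) (at_right 0)" for y :: real
proof -
  have "((\<lambda>t. 1 - exp (- (t * y))) has_real_derivative y) (at 0)"
    by (auto intro!: derivative_eq_intros)
  then have "((\<lambda>t. (1 - exp (- (t * y))) / t) \<longlongrightarrow> y) (at 0)"
    by (simp add: has_field_derivative_iff)
  then show ?thesis by (rule filterlim_mono) (auto simp: at_le)
qed

lemma f_nonneg: "0 \<le> f x"
  using real_char_le_one[OF X_measurable char_X, of 1 x] by simp

lemma f_zero: "f 0 = 0"
proof -
  have "complex_of_real (exp (- (1 * f 0))) = (CLINT \<omega>|P. iexp (0 \<bullet> X 1 \<omega>))"
    by (rule char_X[symmetric]) simp
  also have "\<dots> = complex_of_real 1" by (simp add: prob_space)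
  finally have "exp (- (1 * f 0)) = 1" by (simp only: of_real_eq_iff)
  then show ?thesis by simp
qed

lemma f_uminus: "f (- x) = f x"
proof -
  have "complex_of_real (exp (- (1 * f (- x)))) = (CLINT \<omega>|P. iexp ((- x) \<bullet> X 1 \<omega>))"
    by (rule char_X[symmetric]) simp
  also have "\<dots> = (CLINT \<omega>|P. cnj (iexp (x \<bullet> X 1 \<omega>)))"
    by (simp add: exp_cnj)
  also have "\<dots> = cnj (CLINT \<omega>|P. iexp (x \<bullet> X 1 \<omega>))"
    by (rule Bochner_Integration.integral_cnj)
  also have "\<dots> = complex_of_real (exp (- (1 * f x)))"
    by (subst char_X) auto
  finally have "exp (- (1 * f (- x))) = exp (- (1 * f x))" by (simp only: of_real_eq_iff)
  then show ?thesis by simp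
qed

lemma continuous_on_f: "continuous_on S f"
proof -
  have "continuous_on UNIV (\<lambda>x. exp (- (1 * f x)))"
    by (rule continuous_on_real_char[OF X_measurable char_X]) auto
  then have "continuous_on UNIV (\<lambda>x. - ln (exp (- (1 * f x))))"
    by (intro continuous_on_minus continuous_on_ln) auto
  then show ?thesis by (auto intro: continuous_on_subset)
qed

lemma f_measurable[measurable]: "f \<in> borel_measurable borel"
  by (rule borel_measurable_continuous_onI[OF continuous_on_f])

text \<open>
  \<open>f x\<close> is the limit of \<open>(1 - exp (- t f x)) / t\<close> as \<open>t\<close> tends to 0, so the inequality for characteristic functions
  passes to the exponent.
\<close>

lemma f_add_le:
  assumes \<kappa>: "0 < \<kappa>"
  shows "f (x + y) \<le> (1 + \<kappa>) * f x + (1 + 1 / \<kappa>) * f y"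
proof (rule tendsto_le[OF _ _ one_minus_char_tendsto])
  show "((\<lambda>t. (1 + \<kappa>) * ((1 - exp (- (t * f x))) / t) + (1 + 1 / \<kappa>) * ((1 - exp (- (t * f y))) / t))
      \<longlongrightarrow> (1 + \<kappa>) * f x + (1 + 1 / \<kappa>) * f y) (at_right 0)"
    by (intro tendsto_add tendsto_mult tendsto_const one_minus_char_tendsto)
  show "\<forall>\<^sub>F t in at_right 0. (1 - exp (- (t * f (x + y)))) / t
      \<le> (1 + \<kappa>) * ((1 - exp (- (t * f x))) / t) + (1 + 1 / \<kappa>) * ((1 - exp (- (t * f y))) / t)"
    using eventually_at_right_less[of 0]
  proof eventually_elim
    case (elim t)
    have "1 - exp (- (t * f (x + y))) \<le> (1 + \<kappa>) * (1 - exp (- (t * f x))) + (1 + 1 / \<kappa>) * (1 - exp (- (t * f y)))"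
      using elim by (intro one_minus_real_char_add[OF X_measurable char_X \<kappa>]) auto
    then have "(1 - exp (- (t * f (x + y)))) / t
        \<le> ((1 + \<kappa>) * (1 - exp (- (t * f x))) + (1 + 1 / \<kappa>) * (1 - exp (- (t * f y)))) / t"
      using elim by (intro divide_right_mono) auto
    then show ?case by (simp add: add_divide_distrib)
  qed
qed simp

definition f_star :: "real \<Rightarrow> real" where
  "f_star r = (SUP x\<in>{x. norm x \<le> r}. f x)"

lemma bdd_above_f: "bdd_above (f ` {x. norm x \<le> r})"
proof -
  have "compact (f ` cball 0 r)"
    by (intro compact_continuous_image continuous_on_f compact_cball)
  then show ?thesis by (auto simp: cball_def intro: bounded_imp_bdd_above compact_imp_bounded)
qed

lemma f_le_f_star: "norm x \<le> r \<Longrightarrow> f x \<le> f_star r"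
  unfolding f_star_def by (rule cSUP_upper[OF _ bdd_above_f]) simp

lemma f_star_mono: "0 \<le> u \<Longrightarrow> u \<le> v \<Longrightarrow> f_star u \<le> f_star v"
  unfolding f_star_def by (intro cSUP_subset_mono bdd_above_f) (auto intro: exI[of _ 0])

lemma f_star_nonneg: "0 \<le> u \<Longrightarrow> 0 \<le> f_star u"
  using f_le_f_star[of 0 u] by (simp add: f_zero)

lemma prob_norm_X_ge_le:
  assumes t: "0 \<le> t" and r: "0 < r"
  shows "prob {\<omega> \<in> space P. r \<le> norm (X t \<omega>)} \<le> 2 * DIM('b) * (t * f_star (2 * DIM('b) / r))"
proof (rule prob_norm_ge_le[OF X_measurable[OF t] char_X[OF t] r])
  fix x :: 'b assume x: "norm x \<le> real (2 * DIM('b)) / r"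
  have "1 - exp (- (t * f x)) \<le> t * f x" using exp_ge_add_one_self[of "- (t * f x)"] by linarith
  also have "\<dots> \<le> t * f_star (2 * DIM('b) / r)" using t f_le_f_star[OF x] by (intro mult_left_mono) auto
  finally show "1 - exp (- (t * f x)) \<le> t * f_star (2 * DIM('b) / r)" .
qed

end

locale regular_exponent = symmetric_exponent P X f
  for P :: "'w measure" and X :: "real \<Rightarrow> 'w \<Rightarrow> 'b::euclidean_space" and f :: "'b \<Rightarrow> real" +
  fixes c \<alpha> :: real and V :: "real \<Rightarrow> real" and \<Lambda> :: "'b \<Rightarrow> real"
  assumes c_pos: "0 < c" and comparable: "\<And>x. 1 \<le> norm x \<Longrightarrow> c * f_star (norm x) \<le> f x"
    and alpha: "1 < \<alpha>" and V: "regularly_varying \<alpha> V"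
    and Lambda_pos: "\<And>\<theta>. \<theta> \<in> sphere 0 1 \<Longrightarrow> 0 < \<Lambda> \<theta>"
    and f_V: "\<And>\<theta>. \<theta> \<in> sphere 0 1 \<Longrightarrow> ((\<lambda>s. f (s *\<^sub>R \<theta>) / V s) \<longlongrightarrow> \<Lambda> \<theta>) at_top"
begin

lemma V_pos: "0 \<le> s \<Longrightarrow> 0 < V s"
  using V by (simp add: regularly_varying_def)

lemma V_ratio: "0 < l \<Longrightarrow> ((\<lambda>s. V (l * s) / V s) \<longlongrightarrow> l powr \<alpha>) at_top"
  using V by (simp add: regularly_varying_def)

lemma ray_bounds:
  assumes "norm e = 1" "1 \<le> s"
  shows "c * f_star s \<le> f (s *\<^sub>R e)" "f (s *\<^sub>R e) \<le> f_star s"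
  using comparable[of "s *\<^sub>R e"] f_le_f_star[of "s *\<^sub>R e" s] assms by auto

text \<open>
  The hypothesis on rays extends to all \<open>\<xi> \<noteq> 0\<close> by regular variation at the factor \<open>norm \<xi>\<close>.
\<close>

lemma f_scale_V:
  assumes "\<xi> \<noteq> 0"
  shows "((\<lambda>s. f (s *\<^sub>R \<xi>) / V s) \<longlongrightarrow> \<Lambda> (\<xi> /\<^sub>R norm \<xi>) * norm \<xi> powr \<alpha>) at_top"
proof -
  let ?e = "\<xi> /\<^sub>R norm \<xi>" and ?l = "norm \<xi>"
  have l: "0 < ?l" and e: "?e \<in> sphere 0 1" using assms by auto
  have lim: "filterlim (\<lambda>s. ?l * s) at_top at_top"
    using l by (intro filterlim_tendsto_pos_mult_at_top[OF tendsto_const] filterlim_ident)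
  have "((\<lambda>s. f ((?l * s) *\<^sub>R ?e) / V (?l * s) * (V (?l * s) / V s)) \<longlongrightarrow> \<Lambda> ?e * ?l powr \<alpha>) at_top"
    by (intro tendsto_mult V_ratio l filterlim_compose[OF f_V lim] e)
  then show ?thesis
  proof (rule Lim_transform_eventually)
    show "\<forall>\<^sub>F s in at_top. f ((?l * s) *\<^sub>R ?e) / V (?l * s) * (V (?l * s) / V s) = f (s *\<^sub>R \<xi>) / V s"
      using eventually_ge_at_top[of 0]
    proof eventually_elim
      case (elim s)
      then have "V (?l * s) \<noteq> 0" using V_pos[of "?l * s"] l by simp
      moreover have "f ((?l * s) *\<^sub>R ?e) = f (s *\<^sub>R \<xi>)"
      proof -
        have "(?l * s) *\<^sub>R ?e = (?l * s * inverse ?l) *\<^sub>R \<xi>" by simp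
        also have "?l * s * inverse ?l = s" using assms by (simp add: field_simps)
        finally show ?thesis by (rule arg_cong)
      qed
      ultimately show ?case by (simp del: scaleR_scaleR)
    qed
  qed
qed

lemma potter:
  assumes "0 < a" "a < \<alpha>"
  obtains k where "0 < k" "\<And>s l. 1 \<le> s \<Longrightarrow> 1 \<le> l \<Longrightarrow> k * l powr a * f_star s \<le> f_star (l * s)"
proof -
  obtain e :: 'b where e: "norm e = 1" using vector_choose_size[of 1] by auto
  let ?\<phi> = "\<lambda>s. f (s *\<^sub>R e)"
  have e': "e \<in> sphere 0 1" using e by simp
  have "e \<noteq> 0" using e by auto
  have "((\<lambda>s. f (s *\<^sub>R (2 *\<^sub>R e)) / V s) \<longlongrightarrow> \<Lambda> e * 2 powr \<alpha>) at_top"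
    using f_scale_V[of "2 *\<^sub>R e"] e \<open>e \<noteq> 0\<close> by simp
  then have "((\<lambda>s. f (s *\<^sub>R (2 *\<^sub>R e)) / V s / (?\<phi> s / V s)) \<longlongrightarrow> \<Lambda> e * 2 powr \<alpha> / \<Lambda> e) at_top"
    using Lambda_pos[OF e'] by (intro tendsto_divide f_V[OF e']) auto
  then have "((\<lambda>s. f (s *\<^sub>R (2 *\<^sub>R e)) / V s / (?\<phi> s / V s)) \<longlongrightarrow> 2 powr \<alpha>) at_top"
    using Lambda_pos[OF e'] by simp
  then have "((\<lambda>s. ?\<phi> (2 * s) / ?\<phi> s) \<longlongrightarrow> 2 powr \<alpha>) at_top"
  proof (rule Lim_transform_eventually)
    show "\<forall>\<^sub>F s in at_top. f (s *\<^sub>R (2 *\<^sub>R e)) / V s / (?\<phi> s / V s) = ?\<phi> (2 * s) / ?\<phi> s"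
      using eventually_ge_at_top[of 0]
    proof eventually_elim
      case (elim s)
      then show ?case using V_pos[of s] by (simp add: mult.commute)
    qed
  qed
  from potter_lower_bound[where U=f_star and \<phi>="?\<phi>", OF f_star_mono f_star_nonneg c_pos ray_bounds[OF e] this assms] that
  show thesis by blast
qed

text \<open>
  \<open>f_star\<close> grows at least linearly from any point where it is positive, and \<open>V\<close> is comparable to it at infinity.
\<close>

lemma filterlim_V: "filterlim V at_top at_top"
proof -
  obtain e :: 'b where e: "norm e = 1" using vector_choose_size[of 1] by auto
  then have e': "e \<in> sphere 0 1" by simp
  obtain k where k: "0 < k" "\<And>s l. 1 \<le> s \<Longrightarrow> 1 \<le> l \<Longrightarrow> k * l powr 1 * f_star s \<le> f_star (l * s)"
    using potter[of 1] alpha by auto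
  have "\<forall>\<^sub>F s in at_top. \<Lambda> e / 2 < f (s *\<^sub>R e) / V s"
    "\<forall>\<^sub>F s in at_top. f (s *\<^sub>R e) / V s < 2 * \<Lambda> e"
    using Lambda_pos[OF e'] by (intro order_tendstoD[OF f_V[OF e']]; simp)+
  then have "\<forall>\<^sub>F s in at_top. \<Lambda> e / 2 < f (s *\<^sub>R e) / V s \<and> f (s *\<^sub>R e) / V s < 2 * \<Lambda> e"
    by (rule eventually_conj)
  then obtain s0 where s0: "\<And>s. s0 \<le> s \<Longrightarrow> \<Lambda> e / 2 < f (s *\<^sub>R e) / V s \<and> f (s *\<^sub>R e) / V s < 2 * \<Lambda> e"
    by (auto simp: eventually_at_top_linorder)
  define s1 where "s1 = max 1 s0"
  have s1: "1 \<le> s1" "s0 \<le> s1" by (auto simp: s1_def)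
  have "0 < f (s1 *\<^sub>R e) / V s1" using s0[OF s1(2)] Lambda_pos[OF e'] by linarith
  then have "0 < f (s1 *\<^sub>R e)" using V_pos[of s1] s1 by (simp add: zero_less_divide_iff)
  then have U1: "0 < f_star s1" using ray_bounds(2)[OF e s1(1)] by linarith
  define q where "q = c * k * f_star s1 / (s1 * (2 * \<Lambda> e))"
  have q: "0 < q" using c_pos k U1 s1 Lambda_pos[OF e'] by (simp add: q_def)
  have "\<forall>\<^sub>F s in at_top. q * s \<le> V s"
  proof (rule eventually_at_top_linorderI[of s1])
    fix s assume s: "s1 \<le> s"
    have "k * (s / s1) powr 1 * f_star s1 \<le> f_star (s / s1 * s1)" using s s1 by (intro k) auto
    then have "c * (k * (s / s1) * f_star s1) \<le> c * f_star s"
      using s s1 c_pos by (intro mult_left_mono) auto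
    also have "\<dots> \<le> f (s *\<^sub>R e)" using s s1 by (intro ray_bounds e) auto
    also have "\<dots> \<le> 2 * \<Lambda> e * V s" using s0[of s] s s1 V_pos[of s] by (simp add: field_simps)
    finally show "q * s \<le> V s" using Lambda_pos[OF e'] s1 by (simp add: q_def field_simps)
  qed
  moreover have "filterlim (\<lambda>s. q * s) at_top at_top"
    using q by (intro filterlim_tendsto_pos_mult_at_top[OF tendsto_const] filterlim_ident)
  ultimately show ?thesis by (rule filterlim_at_top_mono[rotated])
qed

text \<open>
  The factor by which the process has to be magnified at time \<open>t\<close> to have a nontrivial limit.
\<close>

definition scale :: "real \<Rightarrow> real" where
  "scale t = generalized_inverse V (1 / t)"

lemma inverse_at_top: "filterlim (\<lambda>t::real. 1 / t) at_top (at_right 0)"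
  using filterlim_inverse_at_top_right by (simp add: inverse_eq_divide)

lemma filterlim_scale: "filterlim scale at_top (at_right 0)"
  unfolding scale_def[abs_def]
  by (rule filterlim_compose[OF generalized_inverse_tendsto_at_top[OF V filterlim_V] inverse_at_top])

lemma V_at_scale: "((\<lambda>t. t * V (scale t)) \<longlongrightarrow> 1) (at_right 0)"
proof -
  obtain e :: 'b where e: "norm e = 1" using vector_choose_size[of 1] by auto
  then have e': "e \<in> sphere 0 1" by simp
  obtain k where k: "0 < k" "\<And>s l. 1 \<le> s \<Longrightarrow> 1 \<le> l \<Longrightarrow> k * l powr 1 * f_star s \<le> f_star (l * s)"
    using potter[of 1] alpha by auto
  have "\<exists>\<eta>>0. \<forall>\<^sub>F s in at_top. \<forall>x\<in>{s..(1 + \<eta>) * s}. V x \<le> (1 + \<epsilon>) * V s" if \<epsilon>: "0 < \<epsilon>" for \<epsilon>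
  proof -
    have sub: "f ((s + r) *\<^sub>R e) \<le> (1 + \<kappa>) * f (s *\<^sub>R e) + (1 + 1 / \<kappa>) * f_star r"
      if "0 < \<kappa>" "0 \<le> s" "0 \<le> r" for \<kappa> s r
    proof -
      have "f ((s + r) *\<^sub>R e) \<le> (1 + \<kappa>) * f (s *\<^sub>R e) + (1 + 1 / \<kappa>) * f (r *\<^sub>R e)"
        using f_add_le[OF that(1), of "s *\<^sub>R e" "r *\<^sub>R e"] by (simp add: scaleR_add_left)
      also have "\<dots> \<le> (1 + \<kappa>) * f (s *\<^sub>R e) + (1 + 1 / \<kappa>) * f_star r"
        using that e by (intro add_left_mono mult_left_mono f_le_f_star) auto
      finally show ?thesis .
    qed
    obtain \<eta> where "0 < \<eta>" "\<forall>\<^sub>F s in at_top. \<forall>x\<in>{s..(1 + \<eta>) * s}. V x \<le> (1 + \<epsilon>) * V s"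
      using almost_increasing_of_subadditive[where U=f_star and \<phi>="\<lambda>s. f (s *\<^sub>R e)" and V=V,
        OF f_star_mono c_pos ray_bounds(1)[OF e] f_nonneg sub k zero_less_one V_pos f_V[OF e'] Lambda_pos[OF e'] \<epsilon>]
      by blast
    then show ?thesis by blast
  qed
  from regularly_varying_generalized_inverse[OF V filterlim_V this]
  have "((\<lambda>t. V (generalized_inverse V (1 / t)) / (1 / t)) \<longlongrightarrow> 1) (at_right 0)"
    by (rule filterlim_compose[OF _ inverse_at_top])
  then show ?thesis by (simp add: scale_def mult.commute)
qed

definition limit_exponent :: "'b \<Rightarrow> real" where
  "limit_exponent \<xi> = \<Lambda> (\<xi> /\<^sub>R norm \<xi>) * norm \<xi> powr \<alpha>"

text \<open>
  Write \<open>t f(s \<xi>)\<close> with \<open>s = scale t\<close> as the product of \<open>t V(s)\<close> and \<open>f(s \<xi>) / V(s)\<close>.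
\<close>

lemma scaled_exponent_tendsto: "((\<lambda>t. t * f (scale t *\<^sub>R \<xi>)) \<longlongrightarrow> limit_exponent \<xi>) (at_right 0)"
proof (cases "\<xi> = 0")
  case True then show ?thesis by (simp add: f_zero limit_exponent_def)
next
  case False
  have "((\<lambda>t. (t * V (scale t)) * (f (scale t *\<^sub>R \<xi>) / V (scale t))) \<longlongrightarrow> 1 * limit_exponent \<xi>) (at_right 0)"
    unfolding limit_exponent_def by (intro tendsto_mult V_at_scale filterlim_compose[OF f_scale_V filterlim_scale] False)
  then have "((\<lambda>t. (t * V (scale t)) * (f (scale t *\<^sub>R \<xi>) / V (scale t))) \<longlongrightarrow> limit_exponent \<xi>) (at_right 0)" by simp
  then show ?thesis
  proof (rule Lim_transform_eventually)
    have "\<forall>\<^sub>F t in at_right 0. 0 < scale t" using filterlim_scale by (simp add: filterlim_at_top_dense)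
    then show "\<forall>\<^sub>F t in at_right 0. (t * V (scale t)) * (f (scale t *\<^sub>R \<xi>) / V (scale t)) = t * f (scale t *\<^sub>R \<xi>)"
    proof eventually_elim
      case (elim t)
      then show ?case using V_pos[of "scale t"] by simp
    qed
  qed
qed

lemma f_star_at_scale_bounds:
  obtains k K where "0 < k" "0 < K" "\<forall>\<^sub>F t in at_right 0. k \<le> t * f_star (scale t) \<and> t * f_star (scale t) \<le> K"
proof -
  obtain e :: 'b where e: "norm e = 1" using vector_choose_size[of 1] by auto
  then have e': "e \<in> sphere 0 1" by simp
  have limit_exponent: "limit_exponent e = \<Lambda> e" "0 < \<Lambda> e" using e Lambda_pos[OF e'] by (auto simp: limit_exponent_def)
  have "\<forall>\<^sub>F t in at_right 0. \<Lambda> e / 2 < t * f (scale t *\<^sub>R e)"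
    "\<forall>\<^sub>F t in at_right 0. t * f (scale t *\<^sub>R e) < 2 * \<Lambda> e"
    using limit_exponent by (intro order_tendstoD[OF scaled_exponent_tendsto]; simp)+
  moreover have "\<forall>\<^sub>F t in at_right 0. 1 \<le> scale t" using filterlim_scale by (simp add: filterlim_at_top)
  ultimately have "\<forall>\<^sub>F t in at_right 0. \<Lambda> e / 2 \<le> t * f_star (scale t) \<and> t * f_star (scale t) \<le> 2 * \<Lambda> e / c"
    using eventually_at_right_less[of 0]
  proof eventually_elim
    case (elim t)
    have 1: "t * f (scale t *\<^sub>R e) \<le> t * f_star (scale t)" and "t * (c * f_star (scale t)) \<le> t * f (scale t *\<^sub>R e)"
      using elim e by (auto intro!: mult_left_mono ray_bounds)
    moreover have "t * (c * f_star (scale t)) = c * (t * f_star (scale t))" by simp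
    ultimately have "c * (t * f_star (scale t)) \<le> 2 * \<Lambda> e" using elim(2) by linarith
    then have "t * f_star (scale t) \<le> 2 * \<Lambda> e / c" using c_pos by (simp add: pos_le_divide_eq mult.commute)
    with 1 elim show ?case by linarith
  qed
  then show thesis using limit_exponent c_pos by (intro that[of "\<Lambda> e / 2" "2 * \<Lambda> e / c"]) auto
qed

text \<open>
  For \<open>norm \<xi> \<ge> 1\<close>, comparability and the growth bound with exponent \<open>1 < \<alpha>\<close> give that \<open>t f(s \<xi>)\<close>, where \<open>s = scale t\<close>, is at least a
  multiple of \<open>t f_star(s) norm \<xi>\<close>, and \<open>t f_star(s)\<close> stays away from 0. The factor \<open>exp k\<close> covers the
  unit ball.
\<close>

lemma char_domination:
  obtains k where "0 < k"
    "\<forall>\<^sub>F t in at_right 0. \<forall>\<xi>. exp (- (t * f (scale t *\<^sub>R \<xi>))) \<le> exp k * exp (- (k * norm \<xi>))"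
proof -
  obtain k where k: "0 < k" "\<And>s l. 1 \<le> s \<Longrightarrow> 1 \<le> l \<Longrightarrow> k * l powr 1 * f_star s \<le> f_star (l * s)"
    using potter[of 1] alpha by auto
  obtain k1 where k1: "0 < k1" "\<forall>\<^sub>F t in at_right 0. k1 \<le> t * f_star (scale t)"
    using f_star_at_scale_bounds by (metis (mono_tags, lifting) eventually_mono)
  let ?k = "c * k * k1"
  have kp: "0 < ?k" using c_pos k k1 by simp
  have "\<forall>\<^sub>F t in at_right 0. 1 \<le> scale t" using filterlim_scale by (simp add: filterlim_at_top)
  with k1(2) have "\<forall>\<^sub>F t in at_right 0. \<forall>\<xi>. exp (- (t * f (scale t *\<^sub>R \<xi>))) \<le> exp ?k * exp (- (?k * norm \<xi>))"
    using eventually_at_right_less[of 0]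
  proof eventually_elim
    case (elim t)
    have "?k * norm \<xi> \<le> ?k + t * f (scale t *\<^sub>R \<xi>)" for \<xi>
    proof (cases "1 \<le> norm \<xi>")
      case True
      have "?k * norm \<xi> = c * k * norm \<xi> * k1" by simp
      also have "\<dots> \<le> c * k * norm \<xi> * (t * f_star (scale t))"
        using elim c_pos k by (intro mult_left_mono) auto
      also have "\<dots> = t * (c * (k * norm \<xi> powr 1 * f_star (scale t)))" by simp
      also have "\<dots> \<le> t * (c * f_star (norm \<xi> * scale t))"
        using elim c_pos True k(2)[of "scale t" "norm \<xi>"] by (intro mult_left_mono) auto
      also have "\<dots> \<le> t * f (scale t *\<^sub>R \<xi>)"
        using elim True comparable[of "scale t *\<^sub>R \<xi>"] mult_mono[of 1 "scale t" 1 "norm \<xi>"]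
        by (intro mult_left_mono) (auto simp: mult.commute)
      finally show ?thesis using kp by linarith
    next
      case False
      then have "?k * norm \<xi> \<le> ?k * 1" using kp by (intro mult_left_mono) auto
      moreover have "0 \<le> t * f (scale t *\<^sub>R \<xi>)" using elim f_nonneg by simp
      ultimately show ?thesis by simp
    qed
    then have "- (t * f (scale t *\<^sub>R \<xi>)) \<le> ?k - ?k * norm \<xi>" for \<xi>
      by (simp add: algebra_simps)
    then show ?case by (simp add: exp_add[symmetric])
  qed
  then show thesis using kp that by blast
qed

text \<open>
  The tail of \<open>X t\<close> beyond \<open>r / scale t\<close> is governed by \<open>t f_star(2 d scale t / r)\<close>, where \<open>d\<close> is the dimension.
  For \<open>2 d \<le> r\<close> the growth bound makes this at most a multiple of \<open>r\<^sup>-\<^sup>a t f_star(scale t)\<close>, provided that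
  the argument of \<open>f_star\<close> is at least \<open>1\<close>, which is where \<open>r \<le> scale t\<close> enters. Beyond that range the
  tail depends on the large jumps and no such decay can be expected.
\<close>

lemma scaled_prob_tail:
  assumes a: "0 < a" "a < \<alpha>"
  obtains K where "0 < K"
    "\<forall>\<^sub>F t in at_right 0. \<forall>r::real. 2 * DIM('b) \<le> r \<and> r \<le> scale t \<longrightarrow>
       prob {\<omega> \<in> space P. r \<le> norm (scale t *\<^sub>R X t \<omega>)} \<le> K * r powr (- a)"
proof -
  let ?d = "2 * real DIM('b)"
  obtain k where k: "0 < k" "\<And>s l. 1 \<le> s \<Longrightarrow> 1 \<le> l \<Longrightarrow> k * l powr a * f_star s \<le> f_star (l * s)"
    using potter[OF a] by auto
  obtain K1 where K1: "0 < K1" "\<forall>\<^sub>F t in at_right 0. t * f_star (scale t) \<le> K1"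
    using f_star_at_scale_bounds by (metis (mono_tags, lifting) eventually_mono)
  let ?K = "?d * ?d powr a * K1 / k"
  have d1: "1 \<le> ?d" using DIM_positive[where 'a='b] by linarith
  have Kp: "0 < ?K" using K1 k d1 by simp
  have "\<forall>\<^sub>F t in at_right 0. 1 \<le> scale t" using filterlim_scale by (simp add: filterlim_at_top)
  with K1(2) have "\<forall>\<^sub>F t in at_right 0. \<forall>r. ?d \<le> r \<and> r \<le> scale t \<longrightarrow>
       prob {\<omega> \<in> space P. r \<le> norm (scale t *\<^sub>R X t \<omega>)} \<le> ?K * r powr (- a)"
    using eventually_at_right_less[of 0]
  proof eventually_elim
    case (elim t)
    show ?case
    proof (intro allI impI)
      fix r assume r: "?d \<le> r \<and> r \<le> scale t"
      have rp: "0 < r" using r d1 by linarith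
      have s: "1 \<le> ?d * scale t / r" using r d1 rp mult_mono[of 1 ?d r "scale t"] by (simp add: field_simps)
      have "k * (r / ?d) powr a * f_star (?d * scale t / r) \<le> f_star (r / ?d * (?d * scale t / r))"
        using r d1 s by (intro k) (auto simp: field_simps)
      also have "r / ?d * (?d * scale t / r) = scale t" using rp d1 by simp
      finally have f_star: "f_star (?d * scale t / r) \<le> ?d powr a * r powr (- a) / k * f_star (scale t)"
        using k(1) rp d1 by (simp add: powr_divide powr_minus field_simps)
      have "{\<omega> \<in> space P. r \<le> norm (scale t *\<^sub>R X t \<omega>)} = {\<omega> \<in> space P. r / scale t \<le> norm (X t \<omega>)}"
        using elim by (auto simp: field_simps)
      then have "prob {\<omega> \<in> space P. r \<le> norm (scale t *\<^sub>R X t \<omega>)} \<le> ?d * (t * f_star (?d / (r / scale t)))"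
        using prob_norm_X_ge_le[of t "r / scale t"] elim rp by simp
      also have "\<dots> = ?d * (t * f_star (?d * scale t / r))" by simp
      also have "\<dots> \<le> ?d * (t * (?d powr a * r powr (- a) / k * f_star (scale t)))"
        using f_star elim by (intro mult_left_mono) auto
      also have "\<dots> = ?d * (?d powr a * r powr (- a) / k) * (t * f_star (scale t))" by simp
      also have "\<dots> \<le> ?d * (?d powr a * r powr (- a) / k) * K1"
        using elim k(1) by (intro mult_left_mono) auto
      also have "\<dots> = ?K * r powr (- a)" by simp
      finally show "prob {\<omega> \<in> space P. r \<le> norm (scale t *\<^sub>R X t \<omega>)} \<le> ?K * r powr (- a)" .
    qed
  qed
  then show thesis using Kp that[of ?K] by simp
qed

end

section \<open>The scaling limit\<close>

context regular_exponent
begin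

text \<open>
  Choose \<open>a\<close> between \<open>b\<close> and \<open>\<alpha>\<close> and cut into dyadic shells. On the shell where the truncated norm lies between
  \<open>2 ^ k\<close> and \<open>2 ^ Suc k\<close>, its \<open>b\<close>-th power is at most \<open>(2 ^ Suc k) powr b\<close> while the probability is at most a
  multiple of \<open>(2 ^ k) powr (- a)\<close>, so
  the contributions form a geometric series with ratio \<open>q = 2 powr (b - a)\<close>. Truncation at \<open>scale t\<close> ensures that
  only shells in the range of the tail estimate occur.
\<close>

lemma tail_moment:
  assumes b: "0 < b" "b < \<alpha>"
  obtains C q :: real and N\<^sub>0 :: nat where "0 < C" "0 < q" "q < 1"
    "\<And>N. N\<^sub>0 \<le> N \<Longrightarrow> \<forall>\<^sub>F t in at_right 0.
       (\<integral>\<^sup>+\<omega>. ennreal (min (norm (scale t *\<^sub>R X t \<omega>)) (scale t) powr b)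
          * indicator {y. 2 ^ N \<le> norm y} (scale t *\<^sub>R X t \<omega>) \<partial>P) \<le> ennreal (C * q ^ N)"
proof -
  define a where "a = (\<alpha> + b) / 2"
  have a: "0 < a" "a < \<alpha>" "b < a" using b by (auto simp: a_def)
  obtain K where K: "0 < K"
    "\<forall>\<^sub>F t in at_right 0. \<forall>r::real. 2 * DIM('b) \<le> r \<and> r \<le> scale t \<longrightarrow>
       prob {\<omega> \<in> space P. r \<le> norm (scale t *\<^sub>R X t \<omega>)} \<le> K * r powr (- a)"
    using scaled_prob_tail[OF a(1,2)] by blast
  define q where "q = (2::real) powr (b - a)"
  have q: "0 < q" "q < 1" using a by (auto simp: q_def powr_less_one)
  define C where "C = 2 powr b * K / (1 - q)"
  have C: "0 < C" using K q by (simp add: C_def)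
  show thesis
  proof (rule that[OF C q])
    fix N assume N: "2 * DIM('b) \<le> N"
    have "real (2 * DIM('b)) \<le> real N" using N by (simp only: of_nat_le_iff)
    also have "real N \<le> 2 ^ N" by (metis less_imp_le of_nat_less_two_power)
    finally have N2: "2 * real DIM('b) \<le> 2 ^ N" by simp
    have "\<forall>\<^sub>F t in at_right 0. 2 ^ N \<le> scale t" using filterlim_scale by (simp add: filterlim_at_top)
    with K(2) show "\<forall>\<^sub>F t in at_right 0. (\<integral>\<^sup>+\<omega>. ennreal (min (norm (scale t *\<^sub>R X t \<omega>)) (scale t) powr b)
          * indicator {y. 2 ^ N \<le> norm y} (scale t *\<^sub>R X t \<omega>) \<partial>P) \<le> ennreal (C * q ^ N)"
      using eventually_at_right_less[of 0]
    proof eventually_elim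
      case (elim t)
      have [measurable]: "random_variable borel (X t)" using elim by (intro X_measurable) simp
      obtain n where n: "scale t < 2 ^ n" using real_arch_pow[of 2 "scale t"] by auto
      define S where "S = {k. N \<le> k \<and> 2 ^ k \<le> scale t}"
      have S_sub: "S \<subseteq> {N..<N + n}"
      proof
        fix k assume "k \<in> S"
        then have k: "N \<le> k" "2 ^ k \<le> scale t" by (auto simp: S_def)
        have "(2::real) ^ k < 2 ^ n" by (rule le_less_trans[OF k(2) n])
        then show "k \<in> {N..<N + n}" using k by auto
      qed
      have finS: "finite S" using S_sub finite_subset by blast
      let ?A = "\<lambda>k. {\<omega> \<in> space P. 2 ^ k \<le> norm (scale t *\<^sub>R X t \<omega>)}"
      have [measurable]: "?A k \<in> sets P" for k :: nat by measurable
      have "ennreal (min (norm (scale t *\<^sub>R X t \<omega>)) (scale t) powr b) * indicator {y. 2 ^ N \<le> norm y} (scale t *\<^sub>R X t \<omega>)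
          \<le> (\<Sum>k\<in>S. ennreal ((2 ^ Suc k) powr b) * indicator (?A k) \<omega>)" if w: "\<omega> \<in> space P" for \<omega>
      proof (cases "2 ^ N \<le> norm (scale t *\<^sub>R X t \<omega>)")
        case True
        define m where "m = min (norm (scale t *\<^sub>R X t \<omega>)) (scale t)"
        have m: "2 ^ N \<le> m" using True elim by (simp add: m_def)
        have m1: "1 \<le> m" using m one_le_power[of "2::real" N] by linarith
        define k where "k = nat \<lfloor>log 2 m\<rfloor>"
        have k: "2 ^ k \<le> m" "m < 2 ^ Suc k"
          using m1 floor_log_eq_powr_iff[of m 2 "\<lfloor>log 2 m\<rfloor>"]
          by (auto simp: k_def powr_realpow[symmetric] powr_add)
        have "(2::real) ^ N < 2 ^ Suc k" using m k by linarith
        then have "N < Suc k" by (rule power_less_imp_less_exp[rotated]) simp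
        then have "N \<le> k" by simp
        then have kS: "k \<in> S" and kA: "\<omega> \<in> ?A k" using k w by (auto simp: S_def m_def)
        have "ennreal (m powr b) \<le> ennreal ((2 ^ Suc k) powr b) * indicator (?A k) \<omega>"
          using k m1 b kA by (auto intro!: ennreal_leI powr_mono2)
        also have "\<dots> \<le> (\<Sum>k\<in>S. ennreal ((2 ^ Suc k) powr b) * indicator (?A k) \<omega>)"
          using kS finS by (intro member_le_sum) auto
        finally show ?thesis using True by (simp add: m_def)
      qed simp
      then have "(\<integral>\<^sup>+\<omega>. ennreal (min (norm (scale t *\<^sub>R X t \<omega>)) (scale t) powr b)
          * indicator {y. 2 ^ N \<le> norm y} (scale t *\<^sub>R X t \<omega>) \<partial>P)
          \<le> (\<integral>\<^sup>+\<omega>. (\<Sum>k\<in>S. ennreal ((2 ^ Suc k) powr b) * indicator (?A k) \<omega>) \<partial>P)"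
        by (intro nn_integral_mono)
      also have "\<dots> = (\<Sum>k\<in>S. ennreal ((2 ^ Suc k) powr b) * emeasure P (?A k))"
        by (simp add: nn_integral_sum nn_integral_cmult_indicator)
      also have "\<dots> \<le> (\<Sum>k\<in>S. ennreal (2 powr b * K * q ^ k))"
      proof (rule sum_mono)
        fix k assume kS: "k \<in> S"
        then have k: "(2::real) ^ N \<le> 2 ^ k" "2 ^ k \<le> scale t" by (auto simp: S_def)
        have "prob (?A k) \<le> K * (2 ^ k) powr (- a)"
        proof (rule elim(1)[rule_format])
          show "real (2 * DIM('b)) \<le> 2 ^ k \<and> 2 ^ k \<le> scale t"
            using k(2) order_trans[OF N2 k(1)] by simp
        qed
        then have "(2 ^ Suc k) powr b * prob (?A k) \<le> (2 ^ Suc k) powr b * (K * (2 ^ k) powr (- a))"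
          by (intro mult_left_mono) auto
        also have "\<dots> = 2 powr b * K * ((2 ^ k) powr b * (2 ^ k) powr (- a))"
          by (simp add: powr_mult)
        also have "(2 ^ k) powr b * (2 ^ k) powr (- a) = q ^ k"
          by (simp add: q_def powr_add[symmetric] powr_realpow[symmetric] powr_powr algebra_simps)
        finally show "ennreal ((2 ^ Suc k) powr b) * emeasure P (?A k) \<le> ennreal (2 powr b * K * q ^ k)"
          by (simp only: emeasure_eq_measure ennreal_mult[symmetric] powr_ge_zero measure_nonneg ennreal_leI)
      qed
      also have "\<dots> = ennreal (\<Sum>k\<in>S. 2 powr b * K * q ^ k)"
        using K q by (intro sum_ennreal) auto
      also have "\<dots> \<le> ennreal (C * q ^ N)"
      proof (rule ennreal_leI)
        have "(\<Sum>k\<in>S. q ^ k) \<le> (\<Sum>k\<in>{N..<N + n}. q ^ k)"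
          using q S_sub by (intro sum_mono2) auto
        also have "\<dots> = (\<Sum>i<n. q ^ N * q ^ i)"
          using sum.shift_bounds_nat_ivl[of "\<lambda>k. q ^ k" 0 N n]
          by (simp add: atLeast0LessThan power_add add.commute mult.commute)
        also have "\<dots> = q ^ N * ((1 - q ^ n) / (1 - q))"
          using q by (simp add: sum_distrib_left[symmetric] sum_gp_strict)
        also have "\<dots> \<le> q ^ N * (1 / (1 - q))"
          using q by (intro mult_left_mono divide_right_mono) auto
        finally have "2 powr b * K * (\<Sum>k\<in>S. q ^ k) \<le> 2 powr b * K * (q ^ N * (1 / (1 - q)))"
          using K by (intro mult_left_mono) auto
        then show "(\<Sum>k\<in>S. 2 powr b * K * q ^ k) \<le> C * q ^ N"
          by (simp only: sum_distrib_left[symmetric]) (simp add: C_def)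
      qed
      finally show ?case .
    qed
  qed
qed

definition scaled_char :: "real \<Rightarrow> 'b \<Rightarrow> complex" where
  "scaled_char t \<xi> = complex_of_real (exp (- (t * f (scale t *\<^sub>R \<xi>))))"

definition limit_density :: "'b \<Rightarrow> real" where
  "limit_density = fourier_density (\<lambda>\<xi>. complex_of_real (exp (- limit_exponent \<xi>)))"

lemma scaled_char_measurable[measurable]: "scaled_char t \<in> borel_measurable borel"
  unfolding scaled_char_def[abs_def] by measurable

lemma scaled_char:
  assumes "0 \<le> t"
  shows "scaled_char t \<xi> = (CLINT y|distr P borel (\<lambda>\<omega>. scale t *\<^sub>R X t \<omega>). iexp (\<xi> \<bullet> y))"
proof -
  have [measurable]: "random_variable borel (X t)" by (rule X_measurable[OF assms])
  have "(CLINT y|distr P borel (\<lambda>\<omega>. scale t *\<^sub>R X t \<omega>). iexp (\<xi> \<bullet> y)) = (CLINT \<omega>|P. iexp (\<xi> \<bullet> (scale t *\<^sub>R X t \<omega>)))"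
    by (rule integral_distr) measurable
  also have "\<dots> = (CLINT \<omega>|P. iexp ((scale t *\<^sub>R \<xi>) \<bullet> X t \<omega>))" by simp
  also have "\<dots> = scaled_char t \<xi>" unfolding scaled_char_def by (rule char_X[OF assms])
  finally show ?thesis ..
qed

lemma scaled_law_density:
  assumes t: "0 \<le> t" and int: "integrable lborel (scaled_char t)"
  shows "0 \<le> fourier_density (scaled_char t) x"
    "distr P borel (\<lambda>\<omega>. scale t *\<^sub>R X t \<omega>) = density lborel (\<lambda>x. ennreal (fourier_density (scaled_char t) x))"
proof -
  have [measurable]: "random_variable borel (X t)" by (rule X_measurable[OF t])
  interpret D: prob_space "distr P borel (\<lambda>\<omega>. scale t *\<^sub>R X t \<omega>)" by (rule prob_space_distr) measurable
  show "0 \<le> fourier_density (scaled_char t) x"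
    "distr P borel (\<lambda>\<omega>. scale t *\<^sub>R X t \<omega>) = density lborel (\<lambda>x. ennreal (fourier_density (scaled_char t) x))"
    using fourier_inversion[OF D.finite_measure_axioms _ scaled_char[OF t] int] by auto
qed

lemma domination_radius:
  obtains k \<delta> where "0 < k" "0 < \<delta>" "\<And>t. 0 < t \<Longrightarrow> t < \<delta> \<Longrightarrow> 1 \<le> scale t"
    "\<And>t \<xi>. 0 < t \<Longrightarrow> t < \<delta> \<Longrightarrow> norm (scaled_char t \<xi>) \<le> exp k * exp (- (k * norm \<xi>))"
proof -
  obtain k where k: "0 < k"
    "\<forall>\<^sub>F t in at_right 0. \<forall>\<xi>. exp (- (t * f (scale t *\<^sub>R \<xi>))) \<le> exp k * exp (- (k * norm \<xi>))"
    using char_domination by blast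
  have "\<forall>\<^sub>F t in at_right 0. 1 \<le> scale t" using filterlim_scale by (simp add: filterlim_at_top)
  with k(2) have "\<forall>\<^sub>F t in at_right 0. (\<forall>\<xi>. exp (- (t * f (scale t *\<^sub>R \<xi>))) \<le> exp k * exp (- (k * norm \<xi>))) \<and> 1 \<le> scale t"
    by (rule eventually_conj)
  then obtain \<delta> where "0 < \<delta>"
    "\<And>t. 0 < t \<Longrightarrow> t < \<delta> \<Longrightarrow> (\<forall>\<xi>. exp (- (t * f (scale t *\<^sub>R \<xi>))) \<le> exp k * exp (- (k * norm \<xi>))) \<and> 1 \<le> scale t"
    by (auto simp: eventually_at_right[OF zero_less_one])
  then show thesis using k(1) that by (auto simp: scaled_char_def)
qed

text \<open>
  Along a sequence of times tending to 0, the laws of the rescaled variables have densities with a common bound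
  that converge pointwise to \<open>limit_density\<close>, by inversion and dominated convergence in the inversion
  integral. The growth condition on \<open>F\<close> matches the truncated moments, so the products of density and \<open>F\<close>
  have uniformly small tails.
\<close>

lemma expectation_tendsto:
  fixes F :: "nat \<Rightarrow> 'b \<Rightarrow> 'c::{banach,second_countable_topology}" and \<tau> :: "nat \<Rightarrow> real"
  assumes b: "0 < b" "b < \<alpha>"
    and \<tau>_pos: "\<And>n. 0 < \<tau> n" and \<tau>_lim: "\<tau> \<longlonglongrightarrow> 0"
    and k: "0 < k" and h1: "\<And>n. 1 \<le> scale (\<tau> n)"
    and dom: "\<And>n \<xi>. norm (scaled_char (\<tau> n) \<xi>) \<le> exp k * exp (- (k * norm \<xi>))"
    and F[measurable]: "\<And>n. F n \<in> borel_measurable borel"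
    and F_lim: "\<And>x. (\<lambda>n. F n x) \<longlonglongrightarrow> F' x"
    and F_le: "\<And>n x. norm (F n x) \<le> K * max 1 (min (norm x) (scale (\<tau> n))) powr b"
  shows "0 \<le> limit_density x" "integrable lborel (\<lambda>x. limit_density x *\<^sub>R F' x)"
    "(\<lambda>n. LINT \<omega>|P. F n (scale (\<tau> n) *\<^sub>R X (\<tau> n) \<omega>)) \<longlonglongrightarrow> (LINT x|lborel. limit_density x *\<^sub>R F' x)"
proof -
  let ?p = "\<lambda>n. fourier_density (scaled_char (\<tau> n))"
  have \<tau>: "filterlim \<tau> (at_right 0) sequentially"
    using \<tau>_pos \<tau>_lim less_imp_neq[OF \<tau>_pos] by (auto simp: filterlim_at intro!: always_eventually)
  let ?w = "\<lambda>\<xi>::'b. exp k * exp (- (k * norm \<xi>))"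
  have w: "integrable lborel ?w" by (intro integrable_mult_right integrable_exp_norm k)
  have int: "integrable lborel (scaled_char (\<tau> n))" for n
    by (rule Bochner_Integration.integrable_bound[OF w]) (use dom in \<open>auto intro!: AE_I2\<close>)
  note p_nonneg = scaled_law_density(1)[OF less_imp_le[OF \<tau>_pos] int]
  note law = scaled_law_density(2)[OF less_imp_le[OF \<tau>_pos] int]
  define B where "B = (LINT \<xi>|lborel. ?w \<xi>) / (2 * pi) ^ DIM('b)"
  have p_le: "?p n x \<le> B" for n x
  proof -
    have "?p n x \<le> \<bar>?p n x\<bar>" by simp
    also have "\<dots> \<le> (LINT \<xi>|lborel. norm (scaled_char (\<tau> n) \<xi>)) / (2 * pi) ^ DIM('b)"
      by (rule abs_fourier_density_le[OF int])
    also have "\<dots> \<le> B"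
      unfolding B_def by (intro divide_right_mono integral_mono w integrable_norm int dom) simp
    finally show ?thesis .
  qed
  have p_lim: "(\<lambda>n. ?p n x) \<longlonglongrightarrow> limit_density x" for x
  proof -
    have c: "(\<lambda>n. scaled_char (\<tau> n) \<xi>) \<longlonglongrightarrow> complex_of_real (exp (- limit_exponent \<xi>))" for \<xi>
      unfolding scaled_char_def
      by (intro tendsto_of_real tendsto_exp tendsto_minus filterlim_compose[OF scaled_exponent_tendsto \<tau>])
    have [measurable]: "(\<lambda>\<xi>. complex_of_real (exp (- limit_exponent \<xi>))) \<in> borel_measurable borel"
      by (rule borel_measurable_LIMSEQ_metric[OF scaled_char_measurable c])
    have "(\<lambda>n. CLINT \<xi>|lborel. iexp (- (\<xi> \<bullet> x)) * scaled_char (\<tau> n) \<xi>)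
        \<longlonglongrightarrow> (CLINT \<xi>|lborel. iexp (- (\<xi> \<bullet> x)) * complex_of_real (exp (- limit_exponent \<xi>)))"
    proof (rule integral_dominated_convergence[OF _ _ w])
      show "AE \<xi> in lborel. (\<lambda>n. iexp (- (\<xi> \<bullet> x)) * scaled_char (\<tau> n) \<xi>) \<longlonglongrightarrow> iexp (- (\<xi> \<bullet> x)) * complex_of_real (exp (- limit_exponent \<xi>))"
        by (intro AE_I2 tendsto_mult tendsto_const c)
      show "AE \<xi> in lborel. norm (iexp (- (\<xi> \<bullet> x)) * scaled_char (\<tau> n) \<xi>) \<le> ?w \<xi>" for n
        using dom by (intro AE_I2) (simp add: norm_mult)
    qed measurable
    then show ?thesis
      unfolding limit_density_def fourier_density_def by (intro tendsto_intros) auto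
  qed
  show "0 \<le> limit_density x" for x
    by (rule LIMSEQ_le_const[OF p_lim]) (use p_nonneg in auto)
  have K: "0 \<le> K" 
  proof -
    have "norm (F 0 0) \<le> K" using F_le[of 0 0] h1[of 0] by simp
    then show ?thesis by (rule order_trans[OF norm_ge_zero])
  qed
  let ?H = "\<lambda>n x. ?p n x *\<^sub>R F n x"
  have expect: "(LINT \<omega>|P. F n (scale (\<tau> n) *\<^sub>R X (\<tau> n) \<omega>)) = (LINT x|lborel. ?H n x)" for n
  proof -
    have [measurable]: "random_variable borel (X (\<tau> n))" by (rule X_measurable[OF less_imp_le[OF \<tau>_pos]])
    have "(LINT \<omega>|P. F n (scale (\<tau> n) *\<^sub>R X (\<tau> n) \<omega>)) = (LINT y|distr P borel (\<lambda>\<omega>. scale (\<tau> n) *\<^sub>R X (\<tau> n) \<omega>). F n y)"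
      by (rule integral_distr[symmetric]) measurable
    also have "\<dots> = (LINT x|lborel. ?H n x)"
      unfolding law by (rule integral_density) (auto simp: p_nonneg)
    finally show ?thesis .
  qed
  have tail_eq: "(\<integral>\<^sup>+x. ennreal (norm (?H n x)) * indicator {x. r \<le> norm x} x \<partial>lborel)
      = (\<integral>\<^sup>+\<omega>. ennreal (norm (F n (scale (\<tau> n) *\<^sub>R X (\<tau> n) \<omega>))) * indicator {x. r \<le> norm x} (scale (\<tau> n) *\<^sub>R X (\<tau> n) \<omega>) \<partial>P)"
    for n r
  proof -
    have [measurable]: "random_variable borel (X (\<tau> n))" by (rule X_measurable[OF less_imp_le[OF \<tau>_pos]])
    have "(\<integral>\<^sup>+\<omega>. ennreal (norm (F n (scale (\<tau> n) *\<^sub>R X (\<tau> n) \<omega>))) * indicator {x. r \<le> norm x} (scale (\<tau> n) *\<^sub>R X (\<tau> n) \<omega>) \<partial>P)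
      = (\<integral>\<^sup>+x. ennreal (norm (F n x)) * indicator {x. r \<le> norm x} x \<partial>distr P borel (\<lambda>\<omega>. scale (\<tau> n) *\<^sub>R X (\<tau> n) \<omega>))"
      by (subst nn_integral_distr) auto
    also have "\<dots> = (\<integral>\<^sup>+x. ennreal (norm (?H n x)) * indicator {x. r \<le> norm x} x \<partial>lborel)"
      unfolding law by (subst nn_integral_density) (auto simp: p_nonneg ennreal_mult mult.assoc)
    finally show ?thesis ..
  qed
  have lim: "(\<lambda>n. ?H n x) \<longlonglongrightarrow> limit_density x *\<^sub>R F' x" for x
    by (intro tendsto_scaleR p_lim F_lim)
  have loc: "\<exists>K. \<forall>n x. norm x \<le> r \<longrightarrow> norm (?H n x) \<le> K" for r
  proof (intro exI allI impI)
    fix n x assume x: "norm (x::'b) \<le> r"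
    have "max 1 (min (norm x) (scale (\<tau> n))) powr b \<le> max 1 r powr b"
      using x b by (intro powr_mono2) auto
    then have "norm (F n x) \<le> K * max 1 r powr b"
      using F_le[of n x] K by (meson mult_left_mono order_trans)
    then show "norm (?H n x) \<le> B * (K * max 1 r powr b)"
      using p_le[of n x] p_nonneg[of n x] by (auto intro!: mult_mono order_trans[OF p_nonneg p_le])
  qed
  have tails: "\<exists>r. \<forall>\<^sub>F n in sequentially.
      (\<integral>\<^sup>+x. ennreal (norm (?H n x)) * indicator {x. r \<le> norm x} x \<partial>lborel) \<le> ennreal \<epsilon>" if \<epsilon>: "0 < \<epsilon>" for \<epsilon>
  proof -
    obtain C q :: real and N\<^sub>0 :: nat where C: "0 < C" "0 < q" "q < 1"
      "\<And>N. N\<^sub>0 \<le> N \<Longrightarrow> \<forall>\<^sub>F t in at_right 0.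
       (\<integral>\<^sup>+\<omega>. ennreal (min (norm (scale t *\<^sub>R X t \<omega>)) (scale t) powr b)
          * indicator {y. 2 ^ N \<le> norm y} (scale t *\<^sub>R X t \<omega>) \<partial>P) \<le> ennreal (C * q ^ N)"
      using tail_moment[OF b] by blast
    have "(\<lambda>N. K * (C * q ^ N)) \<longlonglongrightarrow> K * (C * 0)"
      using C by (intro tendsto_intros LIMSEQ_realpow_zero) auto
    then have "\<forall>\<^sub>F N in sequentially. K * (C * q ^ N) < \<epsilon>"
      using \<epsilon> by (intro order_tendstoD) auto
    with eventually_ge_at_top[of N\<^sub>0] have "\<forall>\<^sub>F N in sequentially. N\<^sub>0 \<le> N \<and> K * (C * q ^ N) < \<epsilon>"
      by (rule eventually_conj)
    then obtain N where N: "N\<^sub>0 \<le> N" "K * (C * q ^ N) < \<epsilon>"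
      by (auto simp: eventually_sequentially)
    have "\<forall>\<^sub>F n in sequentially. (\<integral>\<^sup>+\<omega>. ennreal (min (norm (scale (\<tau> n) *\<^sub>R X (\<tau> n) \<omega>)) (scale (\<tau> n)) powr b)
          * indicator {y. 2 ^ N \<le> norm y} (scale (\<tau> n) *\<^sub>R X (\<tau> n) \<omega>) \<partial>P) \<le> ennreal (C * q ^ N)"
      by (rule eventually_compose_filterlim[OF C(4)[OF N(1)] \<tau>])
    then have "\<forall>\<^sub>F n in sequentially.
      (\<integral>\<^sup>+x. ennreal (norm (?H n x)) * indicator {x. 2 ^ N \<le> norm x} x \<partial>lborel) \<le> ennreal \<epsilon>"
    proof eventually_elim
      case (elim n)
      have [measurable]: "random_variable borel (X (\<tau> n))" by (rule X_measurable[OF less_imp_le[OF \<tau>_pos]])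
      let ?y = "\<lambda>\<omega>. scale (\<tau> n) *\<^sub>R X (\<tau> n) \<omega>"
      have "ennreal (norm (F n y)) * indicator {x. 2 ^ N \<le> norm x} y
          \<le> ennreal K * (ennreal (min (norm y) (scale (\<tau> n)) powr b) * indicator {x. 2 ^ N \<le> norm x} y)" for y
      proof (cases "2 ^ N \<le> norm y")
        case True
        have "1 \<le> norm y" by (rule order_trans[OF _ True]) simp
        then have "1 \<le> min (norm y) (scale (\<tau> n))" using h1[of n] by simp
        then have "norm (F n y) \<le> K * min (norm y) (scale (\<tau> n)) powr b" using F_le[of n y] by (simp add: max_def)
        then show ?thesis using True K by (simp add: ennreal_mult'[symmetric] ennreal_leI)
      qed simp
      then have "(\<integral>\<^sup>+\<omega>. ennreal (norm (F n (?y \<omega>))) * indicator {x. 2 ^ N \<le> norm x} (?y \<omega>) \<partial>P)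
          \<le> (\<integral>\<^sup>+\<omega>. ennreal K * (ennreal (min (norm (?y \<omega>)) (scale (\<tau> n)) powr b) * indicator {x. 2 ^ N \<le> norm x} (?y \<omega>)) \<partial>P)"
        by (intro nn_integral_mono)
      also have "\<dots> = ennreal K * (\<integral>\<^sup>+\<omega>. ennreal (min (norm (?y \<omega>)) (scale (\<tau> n)) powr b) * indicator {x. 2 ^ N \<le> norm x} (?y \<omega>) \<partial>P)"
        by (rule nn_integral_cmult) measurable
      also have "\<dots> \<le> ennreal K * ennreal (C * q ^ N)"
        by (intro mult_left_mono elim) simp
      also have "\<dots> = ennreal (K * (C * q ^ N))" using K by (simp add: ennreal_mult')
      also have "\<dots> \<le> ennreal \<epsilon>" using N by (intro ennreal_leI) simp
      finally show ?case unfolding tail_eq .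
    qed
    then show ?thesis by blast
  qed
  have H_measurable: "?H n \<in> borel_measurable borel" for n by measurable
  from integral_tendsto_of_uniform_tails[of ?H, OF H_measurable lim loc tails]
  show "integrable lborel (\<lambda>x. limit_density x *\<^sub>R F' x)"
    "(\<lambda>n. LINT \<omega>|P. F n (scale (\<tau> n) *\<^sub>R X (\<tau> n) \<omega>)) \<longlonglongrightarrow> (LINT x|lborel. limit_density x *\<^sub>R F' x)"
    unfolding expect by auto
qed

text \<open>
  The continuous-time form. Besides the limit of expectations it yields that \<open>limit_density\<close> is
  nonnegative, as a limit of probability densities, and that the limit functional is integrable.
\<close>

lemma scaled_expectation_tendsto:
  fixes F :: "real \<Rightarrow> 'b \<Rightarrow> 'c::{banach,second_countable_topology}"
  assumes b: "0 < b" "b < \<alpha>"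
    and F: "\<And>t. F t \<in> borel_measurable borel"
    and F_lim: "\<And>x. ((\<lambda>t. F t x) \<longlongrightarrow> F' x) (at_right 0)"
    and F_le: "\<And>t x. 1 \<le> scale t \<Longrightarrow> norm (F t x) \<le> K * max 1 (min (norm x) (scale t)) powr b"
  shows "0 \<le> limit_density x" "integrable lborel (\<lambda>x. limit_density x *\<^sub>R F' x)"
    "((\<lambda>t. LINT \<omega>|P. F t (scale t *\<^sub>R X t \<omega>)) \<longlongrightarrow> (LINT x|lborel. limit_density x *\<^sub>R F' x)) (at_right 0)"
proof -
  obtain k \<delta> where k: "0 < k" and \<delta>: "0 < \<delta>" "\<And>t. 0 < t \<Longrightarrow> t < \<delta> \<Longrightarrow> 1 \<le> scale t"
    "\<And>t \<xi>. 0 < t \<Longrightarrow> t < \<delta> \<Longrightarrow> norm (scaled_char t \<xi>) \<le> exp k * exp (- (k * norm \<xi>))"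
    using domination_radius by blast
  have seq: "0 \<le> limit_density x" "integrable lborel (\<lambda>x. limit_density x *\<^sub>R F' x)"
    "(\<lambda>n. LINT \<omega>|P. F (\<tau> n) (scale (\<tau> n) *\<^sub>R X (\<tau> n) \<omega>)) \<longlonglongrightarrow> (LINT x|lborel. limit_density x *\<^sub>R F' x)"
    if \<tau>: "\<And>n. 0 < \<tau> n" "\<And>n. \<tau> n < \<delta>" "\<tau> \<longlonglongrightarrow> 0" for \<tau> x
  proof -
    have "filterlim \<tau> (at_right 0) sequentially"
      using \<tau> less_imp_neq[OF \<tau>(1)] by (auto simp: filterlim_at intro!: always_eventually)
    then have lim: "(\<lambda>n. F (\<tau> n) x) \<longlonglongrightarrow> F' x" for x
      by (rule filterlim_compose[OF F_lim])
    note * = expectation_tendsto[OF b \<tau>(1,3) k \<delta>(2)[OF \<tau>(1,2)] \<delta>(3)[OF \<tau>(1,2)] F lim F_le[OF \<delta>(2)[OF \<tau>(1,2)]]]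
    show "0 \<le> limit_density x" "integrable lborel (\<lambda>x. limit_density x *\<^sub>R F' x)"
      "(\<lambda>n. LINT \<omega>|P. F (\<tau> n) (scale (\<tau> n) *\<^sub>R X (\<tau> n) \<omega>)) \<longlonglongrightarrow> (LINT x|lborel. limit_density x *\<^sub>R F' x)"
      by (rule *)+
  qed
  define \<tau> where "\<tau> n = \<delta> / real (n + 2)" for n
  have "0 < \<tau> n" "\<tau> n < \<delta>" for n
    using \<delta>(1) mult_strict_left_mono[of 1 "real (n + 2)" \<delta>] by (auto simp: \<tau>_def divide_less_eq)
  moreover have "\<tau> \<longlonglongrightarrow> 0"
    unfolding \<tau>_def using LIMSEQ_ignore_initial_segment[OF lim_const_over_n, of \<delta> 2] by simp
  ultimately show "0 \<le> limit_density x" "integrable lborel (\<lambda>x. limit_density x *\<^sub>R F' x)" for x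
    by (rule seq)+
  show "((\<lambda>t. LINT \<omega>|P. F t (scale t *\<^sub>R X t \<omega>)) \<longlongrightarrow> (LINT x|lborel. limit_density x *\<^sub>R F' x)) (at_right 0)"
    by (rule tendsto_at_right_sequentially[OF \<delta>(1)]) (rule seq(3))
qed

end

section \<open>Small-time behaviour of the heat content\<close>

text \<open>
  Both densities define finite measures with the same Fourier transform.
\<close>

lemma stable_density_unique:
  assumes p: "stable_density \<alpha> \<Lambda> p" and q: "stable_density \<alpha> \<Lambda> q"
  shows "AE x in lborel. p x = q x"
proof -
  have fin: "finite_measure (density lborel (\<lambda>x. ennreal (u x)))"
    and char: "(CLINT y|density lborel (\<lambda>x. ennreal (u x)). iexp (x \<bullet> y))
      = complex_of_real (exp (- (\<Lambda> (x /\<^sub>R norm x) * norm x powr \<alpha>)))"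
    if "stable_density \<alpha> \<Lambda> u" for u x
  proof -
    have [measurable]: "u \<in> borel_measurable borel" and nn: "\<And>y. 0 \<le> u y" and i: "integrable lborel u"
      and eq: "complex_of_real (exp (- (\<Lambda> (x /\<^sub>R norm x) * norm x powr \<alpha>)))
        = (CLINT y|lborel. iexp (x \<bullet> y) * complex_of_real (u y))"
      using that unfolding stable_density_def by auto
    show "finite_measure (density lborel (\<lambda>x. ennreal (u x)))"
      using nn_integral_eq_integral[OF i] nn by (intro finite_measureI) (simp add: emeasure_density)
    have "(CLINT y|density lborel (\<lambda>x. ennreal (u x)). iexp (x \<bullet> y)) = (CLINT y|lborel. u y *\<^sub>R iexp (x \<bullet> y))"
      using nn by (intro integral_density) auto
    then show "(CLINT y|density lborel (\<lambda>x. ennreal (u x)). iexp (x \<bullet> y))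
      = complex_of_real (exp (- (\<Lambda> (x /\<^sub>R norm x) * norm x powr \<alpha>)))"
      unfolding eq by (simp add: scaleR_conv_of_real mult.commute)
  qed
  have "density lborel (\<lambda>x. ennreal (p x)) = density lborel (\<lambda>x. ennreal (q x))"
    by (rule measure_eqI_fourier[OF fin[OF p] _ fin[OF q]]) (simp_all add: char[OF p] char[OF q])
  then have "AE x in lborel. ennreal (p x) = ennreal (q x)"
    using p q by (subst (asm) sigma_finite_measure.density_unique_iff[OF sigma_finite_lborel]) (auto simp: stable_density_def)
  then show ?thesis
    by eventually_elim (use p q in \<open>auto simp: stable_density_def\<close>)
qed

lemma borel_measurable_lim_at_right:
  fixes F :: "real \<Rightarrow> 'a \<Rightarrow> 'b::metric_space"
  assumes F: "\<And>t. F t \<in> borel_measurable M"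
    and lim: "\<And>x. ((\<lambda>t. F t x) \<longlongrightarrow> F' x) (at_right a)"
  shows "F' \<in> borel_measurable M"
proof (rule borel_measurable_LIMSEQ_metric)
  let ?\<tau> = "\<lambda>n. a + inverse (real (Suc n))"
  have "?\<tau> \<longlonglongrightarrow> a + 0" by (intro tendsto_add tendsto_const LIMSEQ_inverse_real_of_nat)
  then have "filterlim ?\<tau> (at_right a) sequentially"
    by (auto simp: filterlim_at simp del: of_nat_Suc intro!: always_eventually)
  then show "(\<lambda>n. F (?\<tau> n) x) \<longlonglongrightarrow> F' x" for x
    by (rule filterlim_compose[OF lim])
qed (rule F)

lemma heat_content_eq:
  fixes X :: "real \<Rightarrow> 'w \<Rightarrow> real ^ 'd"
  assumes P: "prob_space P" and X[measurable]: "X t \<in> borel_measurable P"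
    and g[measurable]: "g \<in> borel_measurable borel" and bdd: "bounded (range g)"
    and \<mu>: "finite_measure \<mu>" and sets[measurable_cong]: "sets \<mu> = sets borel"
  shows "heat_content P X g \<mu> t = (LINT \<omega>|P. translate_integral g \<mu> (X t \<omega>))"
proof -
  interpret P: prob_space P by fact
  interpret \<mu>: finite_measure \<mu> by fact
  interpret pair_sigma_finite P \<mu> ..
  interpret pair: finite_measure "P \<Otimes>\<^sub>M \<mu>" by (intro finite_measure_pair_measure) unfold_locales
  obtain B where B: "\<And>x. norm (g x) \<le> B" using bdd by (auto simp: bounded_iff)
  have "integrable (P \<Otimes>\<^sub>M \<mu>) (\<lambda>(\<omega>, x). g (x + X t \<omega>))"
    using B by (intro pair.integrable_const_bound[of _ B]) auto
  from Fubini_integral[OF this] show ?thesis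
    by (simp add: heat_content_def expectation_from_def translate_integral_def add.commute)
qed

theorem theorem2:
  fixes P :: "'w measure" and X :: "real \<Rightarrow> 'w \<Rightarrow> real ^ 'd"
    and A :: "real ^ 'd ^ 'd" and \<gamma> :: "real ^ 'd" and \<nu> :: "(real ^ 'd) measure"
    and \<psi> :: "real ^ 'd \<Rightarrow> complex"
    and \<alpha> \<beta> c C L :: real
    and V :: "real \<Rightarrow> real" and \<Lambda> R g :: "real ^ 'd \<Rightarrow> real" and \<mu> :: "(real ^ 'd) measure"
  assumes \<beta>: "1 \<le> \<beta>" "\<beta> < 2"
    and levy: "levy_process P X"
    and exponent: "levy_exponent P X A \<gamma> \<nu> \<psi>"
    and symmetric: "symmetric_triplet \<gamma> \<nu>"
    and comparable: "0 < c" "0 < C"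
      "\<And>x. 1 \<le> norm x \<Longrightarrow>
         c * sup_exponent \<psi> (norm x) \<le> Re (\<psi> x) \<and> Re (\<psi> x) \<le> C * sup_exponent \<psi> (norm x)"
    and \<alpha>: "\<beta> < \<alpha>" "\<alpha> \<le> 2"
    and V: "regularly_varying \<alpha> V"
    and \<Lambda>: "continuous_on (sphere 0 1) \<Lambda>" "\<And>\<theta>. \<theta> \<in> sphere 0 1 \<Longrightarrow> 0 < \<Lambda> \<theta>"
    and \<psi>_V: "\<And>\<theta>. \<theta> \<in> sphere 0 1 \<Longrightarrow> ((\<lambda>s. Re (\<psi> (s *\<^sub>R \<theta>)) / V s) \<longlongrightarrow> \<Lambda> \<theta>) at_top"
    and g: "g \<in> borel_measurable borel" "bounded (range g)"
    and \<mu>: "finite_measure \<mu>" "sets \<mu> = sets borel"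
    and R: "\<And>\<theta>. \<theta> \<in> sphere 0 1 \<Longrightarrow>
      ((\<lambda>t. t powr (- \<beta>) * (translate_integral g \<mu> (t *\<^sub>R \<theta>) + translate_integral g \<mu> (- (t *\<^sub>R \<theta>))
              - 2 * translate_integral g \<mu> 0)) \<longlongrightarrow> R \<theta>) (at_right 0)"
    and L: "0 < L"
      "\<And>x. \<bar>translate_integral g \<mu> x + translate_integral g \<mu> (- x) - 2 * translate_integral g \<mu> 0\<bar>
         \<le> L * norm x powr \<beta>"
  shows "(\<exists>p. stable_density \<alpha> \<Lambda> p) \<and>
    (\<forall>p q. stable_density \<alpha> \<Lambda> p \<and> stable_density \<alpha> \<Lambda> q \<longrightarrow> (AE x in lborel. p x = q x)) \<and>
    (\<forall>p. stable_density \<alpha> \<Lambda> p \<longrightarrow>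
       integrable lborel (\<lambda>x. R (x /\<^sub>R norm x) * norm x powr \<beta> * p x) \<and>
       ((\<lambda>t. generalized_inverse V (1 / t) powr \<beta> * (heat_content P X g \<mu> t - heat_content P X g \<mu> 0))
          \<longlongrightarrow> 1 / 2 * (LINT x|lborel. R (x /\<^sub>R norm x) * norm x powr \<beta> * p x)) (at_right 0))"
proof -
  interpret levy: levy_process P X by fact
  interpret \<mu>: finite_measure \<mu> by fact
  note [measurable] = g(1)
  note [measurable_cong] = \<mu>(2)
  \<comment> \<open>Symmetry makes the exponent real, so the process fits the locales above with
      \<open>sup_exponent \<psi>\<close> in the place of \<open>f_star\<close>.\<close>
  define f where "f x = Re (\<psi> x)" for x
  have psi: "\<psi> x = complex_of_real (f x)" for x
    unfolding f_def by (rule levy_exponent_symmetric(2)[OF exponent symmetric])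
  interpret symmetric_exponent P X f
  proof
    show "X t \<in> borel_measurable P" if "0 \<le> t" for t by (rule levy.random_variable_X[OF that])
    show "(CLINT \<omega>|P. iexp (x \<bullet> X t \<omega>)) = complex_of_real (exp (- (t * f x)))" if "0 \<le> t" for t x
      using exponent that by (simp add: levy_exponent_def psi exp_of_real[symmetric])
  qed
  have f_star: "sup_exponent \<psi> u = f_star u" for u
    by (simp add: sup_exponent_def f_star_def f_def)
  interpret regular_exponent P X f c \<alpha> V \<Lambda>
    using comparable \<beta> \<alpha> V \<Lambda> \<psi>_V by unfold_locales (auto simp: f_star f_def)
  have b: "0 < \<beta>" "\<beta> < \<alpha>" using \<beta> \<alpha> by auto

  \<comment> \<open>Apply the limit theorem to the constant \<open>1\<close> and to \<open>y \<mapsto> exp (i \<langle>x, y\<rangle>)\<close>; in the latter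
      case the expectations are the characteristic functions, whose limit is known.\<close>
  have stable: "stable_density \<alpha> \<Lambda> limit_density"
    unfolding stable_density_def
  proof (intro conjI allI)
    have one: "1 \<le> max 1 u powr \<beta>" for u :: real using b by (intro ge_one_powr_ge_zero) auto
    have unit: "0 \<le> limit_density x" "integrable lborel (\<lambda>x. limit_density x *\<^sub>R (1::real))" for x
      using scaled_expectation_tendsto(1,2)[OF b, of "\<lambda>_ _. 1::real" "\<lambda>_. 1" 1] one by auto
    show "0 \<le> limit_density x" for x by (rule unit)
    show i: "integrable lborel limit_density" using unit(2) by simp
    then show "limit_density \<in> borel_measurable borel" by (simp add: borel_measurable_integrable)
    fix x :: "real ^ 'd"
    have "((\<lambda>t. CLINT \<omega>|P. iexp (x \<bullet> (scale t *\<^sub>R X t \<omega>))) \<longlongrightarrow> (CLINT y|lborel. limit_density y *\<^sub>R iexp (x \<bullet> y))) (at_right 0)"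
      by (rule scaled_expectation_tendsto(3)[OF b, of "\<lambda>_ y. iexp (x \<bullet> y)" _ 1]) (auto simp: one)
    moreover have "((\<lambda>t. CLINT \<omega>|P. iexp (x \<bullet> (scale t *\<^sub>R X t \<omega>))) \<longlongrightarrow> complex_of_real (exp (- limit_exponent x))) (at_right 0)"
    proof (rule Lim_transform_eventually)
      show "((\<lambda>t. complex_of_real (exp (- (t * f (scale t *\<^sub>R x))))) \<longlongrightarrow> complex_of_real (exp (- limit_exponent x))) (at_right 0)"
        by (intro tendsto_of_real tendsto_exp tendsto_minus scaled_exponent_tendsto)
      show "\<forall>\<^sub>F t in at_right 0. complex_of_real (exp (- (t * f (scale t *\<^sub>R x)))) = (CLINT \<omega>|P. iexp (x \<bullet> (scale t *\<^sub>R X t \<omega>)))"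
        using eventually_at_right_less[of 0]
      proof eventually_elim
        case (elim t)
        then show ?case using char_X[of t "scale t *\<^sub>R x"] by simp
      qed
    qed
    ultimately have "(CLINT y|lborel. limit_density y *\<^sub>R iexp (x \<bullet> y)) = complex_of_real (exp (- limit_exponent x))"
      by (intro tendsto_unique) auto
    then show "complex_of_real (exp (- (\<Lambda> (x /\<^sub>R norm x) * norm x powr \<alpha>)))
        = (CLINT y|lborel. iexp (x \<bullet> y) * complex_of_real (limit_density y))"
      by (simp add: limit_exponent_def scaleR_conv_of_real mult.commute)
  qed

  define D where "D x = translate_integral g \<mu> x + translate_integral g \<mu> (- x) - 2 * translate_integral g \<mu> 0" for x
  obtain B where B: "\<And>x. \<bar>g x\<bar> \<le> B" using g(2) by (auto simp: bounded_iff)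
  have r_measurable[measurable]: "translate_integral g \<mu> \<in> borel_measurable borel"
    unfolding translate_integral_def[abs_def] by (rule \<mu>.borel_measurable_lebesgue_integral) measurable
  define E where "E = B * measure \<mu> (space \<mu>)"
  have r_le: "\<bar>translate_integral g \<mu> x\<bar> \<le> E" for x
  proof -
    have "\<bar>translate_integral g \<mu> x\<bar> \<le> (LINT y|\<mu>. \<bar>g (x + y)\<bar>)"
      unfolding translate_integral_def by (rule integral_abs_bound)
    also have "\<dots> \<le> (LINT y|\<mu>. B)"
      using B order_trans[OF abs_ge_zero B] by (intro integral_mono \<mu>.integrable_const_bound[of _ B]) auto
    finally show ?thesis by (simp add: E_def mult.commute)
  qed
  have D_measurable[measurable]: "D \<in> borel_measurable borel"
    unfolding D_def[abs_def] by measurable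
  have D_le: "\<bar>D x\<bar> \<le> 4 * E" for x
    unfolding D_def using r_le[of x] r_le[of "- x"] r_le[of 0] by linarith
  have E0: "0 \<le> E" using r_le[of 0] by linarith
  have heat: "heat_content P X g \<mu> t - heat_content P X g \<mu> 0 = 1 / 2 * (LINT \<omega>|P. D (X t \<omega>))" if t: "0 \<le> t" for t
  proof -
    have X[measurable]: "X t \<in> borel_measurable P" by (rule X_measurable[OF t])
    have X0[measurable]: "X 0 \<in> borel_measurable P" by (rule X_measurable) simp
    have i: "integrable P (\<lambda>\<omega>. translate_integral g \<mu> (X t \<omega>))" "integrable P (\<lambda>\<omega>. translate_integral g \<mu> (- X t \<omega>))"
      using r_le by (auto intro!: levy.integrable_const_bound[of _ E])
    have "heat_content P X g \<mu> 0 = (LINT \<omega>|P. translate_integral g \<mu> (X 0 \<omega>))"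
      by (rule heat_content_eq[where X=X and t=0, OF levy.prob_space_axioms X0 g \<mu>])
    also have "\<dots> = (LINT \<omega>|P. translate_integral g \<mu> 0)"
      using levy.X_start by (intro integral_cong_AE) (auto elim: eventually_mono)
    finally have H0: "heat_content P X g \<mu> 0 = translate_integral g \<mu> 0" by (simp add: levy.prob_space)
    \<comment> \<open>The real characteristic function is even, hence the law is symmetric.\<close>
    have law: "distr P borel (X t) = distr P borel (\<lambda>\<omega>. - X t \<omega>)"
    proof (rule measure_eqI_fourier)
      show "finite_measure (distr P borel (X t))" "finite_measure (distr P borel (\<lambda>\<omega>. - X t \<omega>))"
        by (auto intro!: levy.finite_measure_distr)
      fix x :: "real ^ 'd"
      have "(CLINT y|distr P borel (X t). iexp (x \<bullet> y)) = (CLINT \<omega>|P. iexp (x \<bullet> X t \<omega>))"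
        by (rule integral_distr) measurable
      also have "\<dots> = (CLINT \<omega>|P. iexp ((- x) \<bullet> X t \<omega>))"
        unfolding char_X[OF t] f_uminus ..
      also have "\<dots> = (CLINT y|distr P borel (\<lambda>\<omega>. - X t \<omega>). iexp (x \<bullet> y))"
        by (subst integral_distr) auto
      finally show "(CLINT y|distr P borel (X t). iexp (x \<bullet> y)) = (CLINT y|distr P borel (\<lambda>\<omega>. - X t \<omega>). iexp (x \<bullet> y))" .
    qed auto
    have "(LINT \<omega>|P. translate_integral g \<mu> (X t \<omega>)) = (LINT y|distr P borel (X t). translate_integral g \<mu> y)"
      by (subst integral_distr) auto
    also have "\<dots> = (LINT \<omega>|P. translate_integral g \<mu> (- X t \<omega>))"
      unfolding law by (subst integral_distr) auto
    finally have sym: "(LINT \<omega>|P. translate_integral g \<mu> (X t \<omega>)) = (LINT \<omega>|P. translate_integral g \<mu> (- X t \<omega>))" .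
    have "(LINT \<omega>|P. D (X t \<omega>)) = 2 * (LINT \<omega>|P. translate_integral g \<mu> (X t \<omega>)) - 2 * translate_integral g \<mu> 0"
      unfolding D_def using i sym by (simp add: levy.prob_space)
    then show ?thesis
      unfolding H0 heat_content_eq[where X=X and t=t, OF levy.prob_space_axioms X g \<mu>] by simp
  qed

  define F where "F t y = scale t powr \<beta> * D (y /\<^sub>R scale t)" for t y
  define F' where "F' y = R (y /\<^sub>R norm y) * norm y powr \<beta>" for y
  have F_measurable: "F t \<in> borel_measurable borel" for t
    unfolding F_def[abs_def] by measurable
  \<comment> \<open>For \<open>norm y \<le> scale t\<close> use \<open>|D| \<le> L norm\<^sup>\<beta>\<close>; beyond, use that \<open>D\<close> is bounded by \<open>4 E\<close>.\<close>
  have F_le: "norm (F t y) \<le> (L + 4 * E) * max 1 (min (norm y) (scale t)) powr \<beta>" if scale: "1 \<le> scale t" for t y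
  proof -
    have hb: "0 < scale t powr \<beta>" using scale by simp
    have 1: "\<bar>F t y\<bar> = scale t powr \<beta> * \<bar>D (y /\<^sub>R scale t)\<bar>" by (simp add: F_def abs_mult)
    have "scale t powr \<beta> * \<bar>D (y /\<^sub>R scale t)\<bar> \<le> scale t powr \<beta> * (L * norm (y /\<^sub>R scale t) powr \<beta>)"
      unfolding D_def by (intro mult_left_mono L(2)) simp
    also have "\<dots> = L * norm y powr \<beta>"
      using scale by (simp add: powr_mult powr_divide divide_inverse[symmetric] mult.commute)
    finally have 2: "\<bar>F t y\<bar> \<le> L * norm y powr \<beta>" unfolding 1 .
    have 3: "\<bar>F t y\<bar> \<le> 4 * E * scale t powr \<beta>" unfolding 1 using D_le[of "y /\<^sub>R scale t"] hb by (simp add: mult.commute)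
    have "\<bar>F t y\<bar> \<le> (L + 4 * E) * min (norm y) (scale t) powr \<beta>"
    proof (cases "norm y \<le> scale t")
      case True
      have "0 \<le> 4 * E * norm y powr \<beta>" using E0 by simp
      with 2 True show ?thesis by (simp add: distrib_right)
    next
      case False
      have "0 \<le> L * scale t powr \<beta>" using L(1) by simp
      with 3 False show ?thesis by (simp add: distrib_right)
    qed
    also have "\<dots> \<le> (L + 4 * E) * max 1 (min (norm y) (scale t)) powr \<beta>"
      using L(1) E0 b scale by (intro mult_left_mono powr_mono2) auto
    finally show ?thesis by simp
  qed
  \<comment> \<open>In direction \<open>\<theta>\<close>, put \<open>u = norm y / scale t\<close>; then \<open>F t y = norm y\<^sup>\<beta> u\<^sup>-\<^sup>\<beta> D (u \<theta>)\<close>.\<close>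
  have F_lim: "((\<lambda>t. F t y) \<longlongrightarrow> F' y) (at_right 0)" for y
  proof (cases "y = 0")
    case True
    have "D 0 = 0" by (simp add: D_def)
    then show ?thesis using True by (simp add: F_def F'_def)
  next
    case False
    define \<theta> where "\<theta> = y /\<^sub>R norm y"
    have \<theta>: "\<theta> \<in> sphere 0 1" using False by (simp add: \<theta>_def)
    have hpos: "\<forall>\<^sub>F t in at_right 0. 0 < scale t" using filterlim_scale by (simp add: filterlim_at_top_dense)
    have "((\<lambda>t. norm y / scale t) \<longlongrightarrow> 0) (at_right 0)"
      by (rule tendsto_divide_0[OF tendsto_const filterlim_at_top_imp_at_infinity[OF filterlim_scale]])
    then have "filterlim (\<lambda>t. norm y / scale t) (at_right 0) (at_right 0)"
      unfolding filterlim_at using False hpos by (auto elim: eventually_mono)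
    with R[OF \<theta>] have "((\<lambda>t. (norm y / scale t) powr (- \<beta>) * D ((norm y / scale t) *\<^sub>R \<theta>)) \<longlongrightarrow> R \<theta>) (at_right 0)"
      unfolding D_def by (rule filterlim_compose)
    then have "((\<lambda>t. (norm y / scale t) powr (- \<beta>) * D ((norm y / scale t) *\<^sub>R \<theta>) * norm y powr \<beta>) \<longlongrightarrow> R \<theta> * norm y powr \<beta>) (at_right 0)"
      by (intro tendsto_mult tendsto_const)
    then show ?thesis
      unfolding F'_def \<theta>_def[symmetric]
    proof (rule Lim_transform_eventually)
      show "\<forall>\<^sub>F t in at_right 0. (norm y / scale t) powr (- \<beta>) * D ((norm y / scale t) *\<^sub>R \<theta>) * norm y powr \<beta> = F t y"
        using hpos
      proof eventually_elim
        case (elim t)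
        have "(norm y / scale t) *\<^sub>R \<theta> = y /\<^sub>R scale t" using False by (simp add: \<theta>_def divide_inverse)
        moreover have "(norm y / scale t) powr (- \<beta>) * norm y powr \<beta> = scale t powr \<beta>"
          using False elim by (simp add: powr_divide powr_minus field_simps)
        ultimately show ?case by (simp add: F_def)
      qed
    qed
  qed
  have limit: "integrable lborel (\<lambda>x. limit_density x *\<^sub>R F' x)"
    "((\<lambda>t. LINT \<omega>|P. F t (scale t *\<^sub>R X t \<omega>)) \<longlongrightarrow> (LINT x|lborel. limit_density x *\<^sub>R F' x)) (at_right 0)"
    using scaled_expectation_tendsto(2,3)[OF b F_measurable F_lim F_le] by auto

  have scaled: "\<forall>\<^sub>F t in at_right 0. 1 / 2 * (LINT \<omega>|P. F t (scale t *\<^sub>R X t \<omega>))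
      = generalized_inverse V (1 / t) powr \<beta> * (heat_content P X g \<mu> t - heat_content P X g \<mu> 0)"
  proof -
    have "\<forall>\<^sub>F t in at_right 0. 0 < scale t" using filterlim_scale by (simp add: filterlim_at_top_dense)
    then show ?thesis
      using eventually_at_right_less[of 0]
    proof eventually_elim
      case (elim t)
      then have "(LINT \<omega>|P. F t (scale t *\<^sub>R X t \<omega>)) = scale t powr \<beta> * (LINT \<omega>|P. D (X t \<omega>))"
        by (simp add: F_def)
      moreover have "generalized_inverse V (1 / t) = scale t" by (simp add: scale_def)
      ultimately show ?case using elim by (simp add: heat)
    qed
  qed
  show ?thesis
  proof (intro conjI allI impI)
    show "\<exists>p. stable_density \<alpha> \<Lambda> p" using stable by blast
    show "AE x in lborel. p x = q x" if "stable_density \<alpha> \<Lambda> p \<and> stable_density \<alpha> \<Lambda> q" for p q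
      using that stable_density_unique by blast
  next
    fix q assume q: "stable_density \<alpha> \<Lambda> q"
    have [measurable]: "limit_density \<in> borel_measurable borel" "q \<in> borel_measurable borel"
      using stable q by (auto simp: stable_density_def)
    have [measurable]: "F' \<in> borel_measurable borel"
      by (rule borel_measurable_lim_at_right[OF F_measurable F_lim])
    have ae: "AE x in lborel. limit_density x *\<^sub>R F' x = R (x /\<^sub>R norm x) * norm x powr \<beta> * q x"
      using stable_density_unique[OF stable q] by eventually_elim (simp add: F'_def)
    have [measurable]: "(\<lambda>x. R (x /\<^sub>R norm x) * norm x powr \<beta> * q x) \<in> borel_measurable borel"
      unfolding F'_def[symmetric] by measurable
    show "integrable lborel (\<lambda>x. R (x /\<^sub>R norm x) * norm x powr \<beta> * q x)"
      using limit(1) by (subst (asm) integrable_cong_AE[OF _ _ ae]) auto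
    have "(LINT x|lborel. limit_density x *\<^sub>R F' x) = (LINT x|lborel. R (x /\<^sub>R norm x) * norm x powr \<beta> * q x)"
      by (rule integral_cong_AE[OF _ _ ae]) auto
    with limit(2) have "((\<lambda>t. LINT \<omega>|P. F t (scale t *\<^sub>R X t \<omega>)) \<longlongrightarrow> (LINT x|lborel. R (x /\<^sub>R norm x) * norm x powr \<beta> * q x)) (at_right 0)"
      by simp
    then have "((\<lambda>t. 1 / 2 * (LINT \<omega>|P. F t (scale t *\<^sub>R X t \<omega>))) \<longlongrightarrow> 1 / 2 * (LINT x|lborel. R (x /\<^sub>R norm x) * norm x powr \<beta> * q x)) (at_right 0)"
      by (intro tendsto_mult tendsto_const)
    then show "((\<lambda>t. generalized_inverse V (1 / t) powr \<beta> * (heat_content P X g \<mu> t - heat_content P X g \<mu> 0))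
          \<longlongrightarrow> 1 / 2 * (LINT x|lborel. R (x /\<^sub>R norm x) * norm x powr \<beta> * q x)) (at_right 0)"
      by (rule Lim_transform_eventually[OF _ scaled])
  qed
qed

end
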